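(* Let $0<\alpha\le 1$, let $p,q>0$ and $\gamma,\beta,\rho,\delta\in\mathbb{C}$ with $\mathrm{Re}(\gamma)>0$, $\mathrm{Re}(\beta)>0$, $\mathrm{Re}(\rho)>0$, $\mathrm{Re}(\delta)>0$ and $\mathrm{Re}(\gamma)+p\ge q$, and let $\mathcal{V}$ denote the truncated $\mathcal{V}$-fractional derivative of order $\alpha$ with these parameters. Let $n\ge 1$ be an integer, let $r_1,\dots,r_n:[0,\infty)\to\mathbb{R}$ be continuous, and put $Ly=\mathcal{V}^{n}y+\sum_{j=1}^{n} r_j\,\mathcal{V}^{n-j}y$. Let $s,t\in[0,\infty)$. If $f:[0,\infty)\to\mathbb{R}$ is continuous, then the solution of the initial value problem $$Ly=f(t),\qquad \mathcal{V}^{j}y(s)=0,\quad 0\le j\le n-1,$$ is given by $$y(t)=\int_{s}^{t} y(t,\tau)\,f(\tau)\,d_\omega\tau,$$ where $y(t,\tau)$ is the Cauchy function for the equation $Ly=0$.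
   Context: Parameters: $p,q>0$, $\gamma,\beta,\rho,\delta\in\mathbb{C}$ as in the claim, and a truncation index $i$ (a positive integer). Put $(\rho)_{qk}=\Gamma(\rho+qk)/\Gamma(\rho)$, $(\delta)_{pk}=\Gamma(\delta+pk)/\Gamma(\delta)$, and $$H(z)=\Gamma(\beta)\sum_{k=0}^{i}\frac{(\rho)_{qk}}{(\delta)_{pk}}\frac{z^k}{\Gamma(\gamma k+\beta)}.$$ Truncated $\mathcal{V}$-fractional derivative of order $\alpha\in(0,1]$: for $f:[0,\infty)\to\mathbb{R}$ and $t>0$, $$\mathcal{V}f(t)=\lim_{\epsilon\to0}\frac{f\big(t\,H(\epsilon t^{-\alpha})\big)-f(t)}{\epsilon},$$ and $\mathcal{V}f(0)=\lim_{t\to0^+}\mathcal{V}f(t)$ when this limit exists. (Since $f$ is real-valued on $[0,\infty)$, the definition presupposes that $t\,H(\epsilon t^{-\alpha})\in[0,\infty)$ for all sufficiently small real $\epsilon$.) $f$ is called $\alpha$-differentiable where this exists. Iterates: $\mathcal{V}^0f=f$, $\mathcal{V}^{n}f=\mathcal{V}^{n-1}(\mathcal{V}f)$. $\mathcal{V}$-fractional integral: with $K=\dfrac{\Gamma(\gamma+\beta)(\delta)_p}{\Gamma(\beta)(\rho)_q}$, $$\int_a^b f(x)\,d_\omega x:=K\int_a^b f(x)\,x^{\alpha-1}\,dx .$$ A solution on $[0,\infty)$ is a function that is $n$ times $\alpha$-differentiable on $[0,\infty)$ and satisfies the equation there. Cauchy function: the Cauchy function $y:[0,\infty)\times[0,\infty)\to\mathbb{R}$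 for $Ly=0$ is such that for each fixed $s\in[0,\infty)$ the function $y(\cdot,s)$ is the solution of $Ly(\cdot,s)=0$ with $\mathcal{V}^{j}y(s,s)=0$ for $0\le j\le n-2$ and $\mathcal{V}^{n-1}y(s,s)=1$, where the derivatives are taken with respect to the first variable and then evaluated at first variable equal to $s$.
   Formalization: Since Vy(0) ignores y(0), "the solution" is not unique as stated. Proved: the formula gives a solution; any solution equals it for t>0 if s>0 or that solution is continuous, and at t=0 too if that solution and the Cauchy function (in its first variable) are continuous. *)

theory Defs
  imports "HOL-Analysis.Analysis"
begin

text \<open>The quotient \<open>(a)\<^sub>x = \<Gamma>(a + x) / \<Gamma>(a)\<close> with a real subscript; the library's
  \<^const>\<open>pochhammer\<close> only covers natural subscripts.\<close>

definition gen_pochhammer :: "complex \<Rightarrow> real \<Rightarrow> complex" where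
  "gen_pochhammer a x = Gamma (a + of_real x) / Gamma a"

text \<open>The locale has no assumptions; it only carries the parameters.\<close>

locale V_fractional =
  fixes \<alpha> p q :: real and \<gamma> \<beta> \<rho> \<delta> :: complex and i :: nat
begin

definition H :: "complex \<Rightarrow> complex" where
  "H z = Gamma \<beta> * (\<Sum>k=0..i. gen_pochhammer \<rho> (q * real k) / gen_pochhammer \<delta> (p * real k)
                              * (z ^ k / Gamma (\<gamma> * of_nat k + \<beta>)))"

text \<open>The point \<open>t H(\<epsilon> t\<^sup>-\<^sup>\<alpha>)\<close>. It is a priori complex, and functions on \<open>[0,\<infinity>)\<close> can be evaluated
  at it only if it lies in \<^term>\<open>\<real>\<^sub>\<ge>\<^sub>0\<close>; the derivative at \<open>t > 0\<close> exists only if this is so for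
  all small real \<open>\<epsilon> \<noteq> 0\<close>.\<close>

definition V_point :: "real \<Rightarrow> real \<Rightarrow> complex" where
  "V_point t \<epsilon> = of_real t * H (of_real (\<epsilon> * t powr (- \<alpha>)))"

definition has_V_derivative_pos :: "(real \<Rightarrow> real) \<Rightarrow> real \<Rightarrow> real \<Rightarrow> bool" where
  "has_V_derivative_pos f t D \<longleftrightarrow>
     0 < t \<and>
     (\<forall>\<^sub>F \<epsilon> in at (0::real). V_point t \<epsilon> \<in> \<real>\<^sub>\<ge>\<^sub>0) \<and>
     ((\<lambda>\<epsilon>. (f (Re (V_point t \<epsilon>)) - f t) / \<epsilon>) \<longlongrightarrow> D) (at 0)"

text \<open>At \<open>t = 0\<close> the derivative is the right limit of the derivatives at positive points. In
  particular it does not involve \<open>f 0\<close>, so it does not force \<open>f\<close> to be continuous at \<open>0\<close>.\<close>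

definition has_V_derivative :: "(real \<Rightarrow> real) \<Rightarrow> real \<Rightarrow> real \<Rightarrow> bool" where
  "has_V_derivative f t D \<longleftrightarrow>
     has_V_derivative_pos f t D \<or>
     t = 0 \<and> (\<exists>g. (\<forall>\<^sub>F x in at_right 0. has_V_derivative_pos f x (g x)) \<and>
                  (g \<longlongrightarrow> D) (at_right 0))"

definition V_differentiable :: "(real \<Rightarrow> real) \<Rightarrow> real \<Rightarrow> bool" where
  "V_differentiable f t \<longleftrightarrow> (\<exists>D. has_V_derivative f t D)"

text \<open>Meaningful only where \<^const>\<open>V_differentiable\<close> holds. The iterates are \<open>V ^^ k\<close>.\<close>

definition V :: "(real \<Rightarrow> real) \<Rightarrow> real \<Rightarrow> real" where
  "V f t = (THE D. has_V_derivative f t D)"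

definition n_times_V_differentiable :: "nat \<Rightarrow> (real \<Rightarrow> real) \<Rightarrow> bool" where
  "n_times_V_differentiable n f \<longleftrightarrow> (\<forall>k<n. \<forall>t\<ge>0. V_differentiable ((V ^^ k) f) t)"

definition K :: complex where
  "K = Gamma (\<gamma> + \<beta>) * gen_pochhammer \<delta> p / (Gamma \<beta> * gen_pochhammer \<rho> q)"

text \<open>For \<open>i \<ge> 1\<close> one has \<open>H' 0 = 1 / K\<close>. As soon as some function has a derivative at some
  \<open>t > 0\<close>, the polynomial \<^const>\<open>H\<close> takes real values near \<open>0\<close> on the real line, so \<^const>\<open>K\<close>
  is real and \<open>Re K\<close> is just \<open>K\<close>. The integral is oriented: \<open>b < a\<close> is allowed.\<close>

definition V_integral :: "real \<Rightarrow> real \<Rightarrow> (real \<Rightarrow> real) \<Rightarrow> real" where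
  "V_integral a b f = Re K * (LBINT x=ereal a..ereal b. f x * x powr (\<alpha> - 1))"

definition L :: "nat \<Rightarrow> (nat \<Rightarrow> real \<Rightarrow> real) \<Rightarrow> (real \<Rightarrow> real) \<Rightarrow> real \<Rightarrow> real" where
  "L n r y t = (V ^^ n) y t + (\<Sum>j=1..n. r j t * (V ^^ (n - j)) y t)"

definition solution ::
  "nat \<Rightarrow> (nat \<Rightarrow> real \<Rightarrow> real) \<Rightarrow> (real \<Rightarrow> real) \<Rightarrow> (real \<Rightarrow> real) \<Rightarrow> bool" where
  "solution n r f y \<longleftrightarrow> n_times_V_differentiable n y \<and> (\<forall>t\<ge>0. L n r y t = f t)"

definition zero_ivp_solution ::
  "nat \<Rightarrow> (nat \<Rightarrow> real \<Rightarrow> real) \<Rightarrow> (real \<Rightarrow> real) \<Rightarrow> real \<Rightarrow> (real \<Rightarrow> real) \<Rightarrow> bool" where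
  "zero_ivp_solution n r f s y \<longleftrightarrow> solution n r f y \<and> (\<forall>j<n. (V ^^ j) y s = 0)"

text \<open>The derivatives act on the first variable of \<open>Y\<close>.\<close>

definition cauchy_function ::
  "nat \<Rightarrow> (nat \<Rightarrow> real \<Rightarrow> real) \<Rightarrow> (real \<Rightarrow> real \<Rightarrow> real) \<Rightarrow> bool" where
  "cauchy_function n r Y \<longleftrightarrow>
     (\<forall>s\<ge>0. solution n r (\<lambda>_. 0) (\<lambda>t. Y t s) \<and>
            (\<forall>j<n - 1. (V ^^ j) (\<lambda>t. Y t s) s = 0) \<and>
            (V ^^ (n - 1)) (\<lambda>t. Y t s) s = 1)"

end

end

theory Submission
  imports Defs
begin

text \<open>On \<open>(0, \<infinity>)\<close> the operator \<open>V\<close> is \<open>(1 / K) t\<^sup>1\<^sup>-\<^sup>\<alpha> d/dt\<close>, so in the variable \<open>x = t\<^sup>\<alpha> / \<alpha>\<close> it is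
  \<open>(1 / K) d/dx\<close>, and the equation becomes a linear first order system with continuous coefficients
  on \<open>[0, \<infinity>)\<close>. The Cauchy function need not behave well at \<open>t = 0\<close> or \<open>\<tau> = 0\<close>, because \<open>V\<close>
  at \<open>0\<close> does not see the value of the function there. But a Gronwall estimate for the energy, the
  sum of the squares of the components, makes the solution starting at \<open>\<xi> > 0\<close> Lipschitz in
  \<open>(x, \<xi>)\<close>, with constants that stay bounded near the axes. It therefore extends continuously to the
  closed quadrant. Differentiating the integral of this extension shows that the formula solves
  the problem, and the energy estimate gives uniqueness. At \<open>t = 0\<close> the value of the Cauchy function
  enters the equation only through \<open>r\<^sub>n(0)\<close>, and if \<open>r\<^sub>n(0) \<noteq> 0\<close> the homogeneous equation forces
  this value to be the continuous one.\<close>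

subsection \<open>Energy estimate for linear systems\<close>

text \<open>The model system in the variable x. It is instantiated later with \<kappa> =
  \<open>Re K\<close> and with the coefficients \<open>r j\<close> pulled back by the inverse change
  of variable. Continuity of \<open>R j\<close> is demanded up to the endpoint 0, which is the
  source of all bounds that are uniform near 0.\<close>

locale linear_chain =
  fixes n :: nat and \<kappa> :: real and R :: "nat \<Rightarrow> real \<Rightarrow> real"
  assumes n_pos: "1 \<le> n"
    and R_cont: "\<And>j. j \<in> {1..n} \<Longrightarrow> continuous_on {0..} (R j)"
begin

text \<open>Only x > 0 is constrained, so the values of the components at 0 are free, as they are
  for iterates of \<open>V\<close>. The top component is not differentiated; the equation expresses
  it through the lower ones.\<close>

definition chain :: "(real \<Rightarrow> real) \<Rightarrow> (nat \<Rightarrow> real \<Rightarrow> real) \<Rightarrow> bool" where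
  "chain g u \<longleftrightarrow>
     (\<forall>x>0. (\<forall>j<n. (u j has_real_derivative \<kappa> * u (Suc j) x) (at x)) \<and>
            u n x = g x - (\<Sum>j=1..n. R j x * u (n - j) x))"

definition energy :: "(nat \<Rightarrow> real \<Rightarrow> real) \<Rightarrow> real \<Rightarrow> real" where
  "energy u x = (\<Sum>j<n. (u j x)\<^sup>2)"

lemma chainD:
  assumes "chain g u" "0 < x"
  shows "j < n \<Longrightarrow> (u j has_real_derivative \<kappa> * u (Suc j) x) (at x)"
    and "u n x = g x - (\<Sum>j=1..n. R j x * u (n - j) x)"
  using assms unfolding chain_def by auto

lemma chain_diff:
  assumes "chain g u" "chain h v"
  shows "chain (\<lambda>x. g x - h x) (\<lambda>j x. u j x - v j x)"
  unfolding chain_def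
  using chainD[OF assms(1)] chainD[OF assms(2)]
  by (auto intro!: derivative_eq_intros simp: algebra_simps sum_subtractf)

lemma energy_nonneg: "0 \<le> energy u x"
  by (simp add: energy_def sum_nonneg)

lemma abs_le_sqrt_energy: "j < n \<Longrightarrow> \<bar>u j x\<bar> \<le> sqrt (energy u x)"
proof -
  assume "j < n"
  then have "(u j x)\<^sup>2 \<le> energy u x"
    unfolding energy_def by (intro member_le_sum) auto
  then show ?thesis by (simp add: real_le_rsqrt)
qed

lemma coefficients_bounded:
  obtains M where "0 \<le> M" "\<And>x. x \<in> {0..T} \<Longrightarrow> (\<Sum>j=1..n. (R j x)\<^sup>2) \<le> M"
proof -
  have "continuous_on {0..T} (\<lambda>x. \<Sum>j=1..n. (R j x)\<^sup>2)"
    by (intro continuous_intros continuous_on_subset[OF R_cont]) auto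
  then have "bounded ((\<lambda>x. \<Sum>j=1..n. (R j x)\<^sup>2) ` {0..T})"
    by (simp add: compact_continuous_image compact_imp_bounded)
  then obtain M where M: "\<And>x. x \<in> {0..T} \<Longrightarrow> \<bar>\<Sum>j=1..n. (R j x)\<^sup>2\<bar> \<le> M"
    unfolding bounded_iff by (metis imageI real_norm_def)
  show thesis
  proof (rule that[of "max 0 M"])
    fix x assume "x \<in> {0..T}"
    with M[OF this] show "(\<Sum>j=1..n. (R j x)\<^sup>2) \<le> max 0 M" by linarith
  qed simp
qed

lemma sum_shift_energy: "(\<Sum>j=1..n. (u (n - j) x)\<^sup>2) = energy u x"
  unfolding energy_def
  by (rule sum.reindex_bij_witness[of _ "\<lambda>j. n - j" "\<lambda>j. n - j"]) auto

text \<open>Cauchy-Schwarz applied to the equation. It closes the energy estimate, because the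
  derivative of \<open>u (n - 1)\<close> involves \<open>u n\<close>, which is not part of the
  energy.\<close>

lemma top_square_le:
  assumes "chain (\<lambda>_. 0) u" "0 < x" "(\<Sum>j=1..n. (R j x)\<^sup>2) \<le> M"
  shows "(u n x)\<^sup>2 \<le> M * energy u x"
proof -
  have "(u n x)\<^sup>2 = (\<Sum>j=1..n. R j x * u (n - j) x)\<^sup>2"
    using chainD(2)[OF assms(1,2)] by simp
  also have "\<dots> \<le> (\<Sum>j=1..n. (R j x)\<^sup>2) * (\<Sum>j=1..n. (u (n - j) x)\<^sup>2)"
    by (rule Cauchy_Schwarz_ineq_sum)
  also have "\<dots> \<le> M * energy u x"
    unfolding sum_shift_energy by (rule mult_right_mono[OF assms(3) energy_nonneg])
  finally show ?thesis .
qed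

text \<open>Gronwall in both directions. If E' is bounded in absolute value by C E, then E exp(-C x)
  is nonincreasing and E exp(C x) is nondecreasing, so the two points may come in either order. Both
  may be arbitrarily close to 0 without affecting the constant.\<close>

lemma energy_growth:
  assumes "chain (\<lambda>_. 0) u" and M: "\<And>x. x \<in> {0..T} \<Longrightarrow> (\<Sum>j=1..n. (R j x)\<^sup>2) \<le> M"
    and xs: "x \<in> {0<..T}" "x0 \<in> {0<..T}" and "0 \<le> M"
  shows "energy u x \<le> exp (\<bar>\<kappa>\<bar> * (2 + M) * T) * energy u x0"
proof -
  define C where "C = \<bar>\<kappa>\<bar> * (2 + M)"
  have C0: "0 \<le> C" using \<open>0 \<le> M\<close> by (simp add: C_def)
  define E' where "E' x = (\<Sum>j<n. 2 * u j x * (\<kappa> * u (Suc j) x))" for x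
  have deriv: "(energy u has_real_derivative E' x) (at x)" if "0 < x" for x
    unfolding energy_def E'_def
    by (auto intro!: derivative_eq_intros chainD(1)[OF assms(1) that] simp: algebra_simps)
  have bound: "\<bar>E' x\<bar> \<le> C * energy u x" if "x \<in> {0<..T}" for x
  proof -
    have "\<bar>E' x\<bar> \<le> (\<Sum>j<n. \<bar>2 * u j x * (\<kappa> * u (Suc j) x)\<bar>)"
      unfolding E'_def by (rule sum_abs)
    also have "\<dots> \<le> (\<Sum>j<n. \<bar>\<kappa>\<bar> * ((u j x)\<^sup>2 + (u (Suc j) x)\<^sup>2))"
    proof (rule sum_mono)
      fix j
      have "\<bar>u j x\<bar> * \<bar>u (Suc j) x\<bar> * 2 \<le> (u j x)\<^sup>2 + (u (Suc j) x)\<^sup>2"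
        using sum_squares_bound[of "\<bar>u j x\<bar>" "\<bar>u (Suc j) x\<bar>"] by (simp add: mult_ac)
      then show "\<bar>2 * u j x * (\<kappa> * u (Suc j) x)\<bar> \<le> \<bar>\<kappa>\<bar> * ((u j x)\<^sup>2 + (u (Suc j) x)\<^sup>2)"
        using mult_left_mono[of _ _ "\<bar>\<kappa>\<bar>"] by (fastforce simp: abs_mult mult_ac)
    qed
    also have "\<dots> = \<bar>\<kappa>\<bar> * (energy u x + (\<Sum>j<n. (u (Suc j) x)\<^sup>2))"
      by (simp add: energy_def sum_distrib_left sum.distrib distrib_left)
    also have "\<dots> \<le> \<bar>\<kappa>\<bar> * (energy u x + (energy u x + M * energy u x))"
    proof -
      \<comment> \<open>The index shift loses the square of \<open>u 0\<close> and gains that of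
        \<open>u n\<close>, which \<open>top_square_le\<close> controls.\<close>
      have "(\<Sum>j<n. (u (Suc j) x)\<^sup>2) = energy u x - (u 0 x)\<^sup>2 + (u n x)\<^sup>2"
        unfolding energy_def using sum.lessThan_Suc_shift[of "\<lambda>j. (u j x)\<^sup>2" n] by simp
      moreover have "(u n x)\<^sup>2 \<le> M * energy u x"
        using that by (intro top_square_le[OF assms(1)] M) auto
      ultimately have "(\<Sum>j<n. (u (Suc j) x)\<^sup>2) \<le> energy u x + M * energy u x"
        using zero_le_power2[of "u 0 x"] by linarith
      then show ?thesis by (simp add: mult_left_mono)
    qed
    finally show ?thesis by (simp add: C_def algebra_simps)
  qed
  have up: "energy u b \<le> energy u a * exp (C * (b - a))"
    if ab: "a \<in> {0<..T}" "b \<in> {0<..T}" "a \<le> b" for a b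
  proof -
    have "energy u b * exp (- C * b) \<le> energy u a * exp (- C * a)"
    proof (rule DERIV_nonpos_imp_nonincreasing[OF ab(3)], intro exI conjI)
      fix x assume x: "a \<le> x" "x \<le> b"
      then have "0 < x" using ab by auto
      then show "((\<lambda>x. energy u x * exp (- C * x)) has_real_derivative
          (E' x - C * energy u x) * exp (- C * x)) (at x)"
        by (auto intro!: derivative_eq_intros deriv simp: algebra_simps)
      show "(E' x - C * energy u x) * exp (- C * x) \<le> 0"
        using bound[of x] x ab by (auto intro!: mult_nonpos_nonneg)
    qed
    then show ?thesis by (simp add: exp_minus exp_diff field_simps right_diff_distrib)
  qed
  have down: "energy u a \<le> energy u b * exp (C * (b - a))"
    if ab: "a \<in> {0<..T}" "b \<in> {0<..T}" "a \<le> b" for a b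
  proof -
    have "energy u a * exp (C * a) \<le> energy u b * exp (C * b)"
    proof (rule DERIV_nonneg_imp_nondecreasing[OF ab(3)], intro exI conjI)
      fix x assume x: "a \<le> x" "x \<le> b"
      then have "0 < x" using ab by auto
      then show "((\<lambda>x. energy u x * exp (C * x)) has_real_derivative
          (E' x + C * energy u x) * exp (C * x)) (at x)"
        by (auto intro!: derivative_eq_intros deriv simp: algebra_simps)
      show "0 \<le> (E' x + C * energy u x) * exp (C * x)"
        using bound[of x] x ab by auto
    qed
    then show ?thesis by (simp add: exp_minus exp_diff field_simps right_diff_distrib)
  qed
  \<comment> \<open>Replacing the distance of the two points by T makes the factor independent of
    them.\<close>
  have *: "energy u x0 * exp (C * d) \<le> exp (C * T) * energy u x0" if "d \<le> T" for d
    using that C0 energy_nonneg[of u x0] by (simp add: mult.commute mult_left_mono)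
  show ?thesis
  proof (cases "x0 \<le> x")
    case True
    from up[OF xs(2,1) True] *[of "x - x0"] xs show ?thesis by (auto simp: C_def)
  next
    case False
    from down[OF xs] *[of "x0 - x"] False xs show ?thesis by (auto simp: C_def)
  qed
qed

lemma energy_estimate:
  obtains B where "0 < B"
    "\<And>u x x0. chain (\<lambda>_. 0) u \<Longrightarrow> x \<in> {0<..T} \<Longrightarrow> x0 \<in> {0<..T} \<Longrightarrow> energy u x \<le> B * energy u x0"
proof -
  obtain M where M: "0 \<le> M" "\<And>x. x \<in> {0..T} \<Longrightarrow> (\<Sum>j=1..n. (R j x)\<^sup>2) \<le> M"
    using coefficients_bounded[of T] by metis
  show thesis
    by (rule that[of "exp (\<bar>\<kappa>\<bar> * (2 + M) * T)"]) (auto intro!: energy_growth M)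
qed

text \<open>The constant B does not depend on the starting point, so that point can be sent to 0
  from the right in the energy estimate. The values at 0 itself never enter.\<close>

lemma chain_zero_if_tendsto:
  assumes u: "chain (\<lambda>_. 0) u" and lim: "\<And>j. j < n \<Longrightarrow> (u j \<longlongrightarrow> 0) (at_right 0)"
    and "0 < x" "j < n"
  shows "u j x = 0"
proof -
  obtain B where B: "\<And>z x0. z \<in> {0<..x} \<Longrightarrow> x0 \<in> {0<..x} \<Longrightarrow> energy u z \<le> B * energy u x0"
    using energy_estimate[of x] u by metis
  have "((\<lambda>y. B * energy u y) \<longlongrightarrow> B * (\<Sum>j<n. 0\<^sup>2)) (at_right 0)"
    unfolding energy_def by (intro tendsto_intros lim) auto
  moreover have "\<forall>\<^sub>F y in at_right 0. energy u x \<le> B * energy u y"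
    using \<open>0 < x\<close> B by (auto simp: eventually_at_right_field intro!: exI[of _ x])
  ultimately have "energy u x \<le> 0"
    using tendsto_lowerbound by fastforce
  with abs_le_sqrt_energy[OF \<open>j < n\<close>, of u x] show ?thesis
    using energy_nonneg[of u x] by simp
qed

lemma chain_zero_if_zero:
  assumes u: "chain (\<lambda>_. 0) u" and "\<And>j. j < n \<Longrightarrow> u j x0 = 0" "0 < x0" "0 < x" "j < n"
  shows "u j x = 0"
proof -
  obtain B where "energy u x \<le> B * energy u x0"
    using energy_estimate[of "max x x0"] u \<open>0 < x\<close> \<open>0 < x0\<close> by (metis greaterThanAtMost_iff max.cobounded1 max.cobounded2)
  also have "energy u x0 = 0" by (simp add: energy_def assms)
  finally have "energy u x \<le> 0" by simp
  with abs_le_sqrt_energy[OF \<open>j < n\<close>, of u x] show ?thesis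
    using energy_nonneg[of u x] by simp
qed

text \<open>The energy is 1 on the diagonal, hence bounded everywhere, and the equation then bounds
  the derivatives in x; this gives the Lipschitz bound in x. For the parameter, the difference of
  the solutions started at \<xi> and \<xi>' is again a homogeneous chain, so it is enough to
  estimate it at the single point \<xi>'.\<close>

lemma propagator_lipschitz:
  fixes U :: "nat \<Rightarrow> real \<Rightarrow> real \<Rightarrow> real"
  assumes U: "\<And>\<xi>. 0 < \<xi> \<Longrightarrow> chain (\<lambda>_. 0) (\<lambda>j x. U j x \<xi>)"
    and diag: "\<And>j \<xi>. j < n \<Longrightarrow> 0 < \<xi> \<Longrightarrow> U j \<xi> \<xi> = (if j = n - 1 then 1 else 0)"
  obtains \<Lambda> where "0 \<le> \<Lambda>" "\<And>j x x' \<xi> \<xi>'. j < n \<Longrightarrow> {x, x', \<xi>, \<xi>'} \<subseteq> {0<..T} \<Longrightarrow>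
    \<bar>U j x \<xi> - U j x' \<xi>'\<bar> \<le> \<Lambda> * (\<bar>x - x'\<bar> + \<bar>\<xi> - \<xi>'\<bar>)"
proof -
  obtain B where B: "0 < B"
    "\<And>u x x0. chain (\<lambda>_. 0) u \<Longrightarrow> x \<in> {0<..T} \<Longrightarrow> x0 \<in> {0<..T} \<Longrightarrow> energy u x \<le> B * energy u x0"
    using energy_estimate[of T] by metis
  obtain M where M: "0 \<le> M" "\<And>x. x \<in> {0..T} \<Longrightarrow> (\<Sum>j=1..n. (R j x)\<^sup>2) \<le> M"
    using coefficients_bounded[of T] by metis
  \<comment> \<open>The first entry bounds the components below n, the second bounds the top one,
    which occurs as the derivative of component n - 1.\<close>
  define N where "N = max (sqrt B) (sqrt (M * B))"
  have N0: "0 \<le> N" by (simp add: N_def B less_imp_le max.coboundedI1)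
  have energy_diag: "energy (\<lambda>j x. U j x \<xi>) \<xi> = 1" if "0 < \<xi>" for \<xi>
  proof -
    have "energy (\<lambda>j x. U j x \<xi>) \<xi> = (\<Sum>j<n. if j = n - 1 then 1 else 0)"
      unfolding energy_def by (rule sum.cong) (auto simp: diag that)
    then show ?thesis using n_pos by simp
  qed
  have energy_le: "energy (\<lambda>j x. U j x \<xi>) x \<le> B" if "x \<in> {0<..T}" "\<xi> \<in> {0<..T}" for x \<xi>
    using B(2)[OF U that, of \<xi>] energy_diag[of \<xi>] that by simp
  have bounded: "\<bar>U j x \<xi>\<bar> \<le> N" if "j \<le> n" and x: "x \<in> {0<..T}" "\<xi> \<in> {0<..T}" for j x \<xi>
  proof (cases "j < n")
    case True
    have "\<bar>U j x \<xi>\<bar> \<le> sqrt (energy (\<lambda>j x. U j x \<xi>) x)"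
      using abs_le_sqrt_energy[OF True, of "\<lambda>j x. U j x \<xi>"] .
    also have "\<dots> \<le> sqrt B" using energy_le[OF x] by simp
    finally show ?thesis by (simp add: N_def)
  next
    case False
    then have "j = n" using that by simp
    have "(U n x \<xi>)\<^sup>2 \<le> M * energy (\<lambda>j x. U j x \<xi>) x"
      using top_square_le[OF U[of \<xi>], of x M] M(2)[of x] x by auto
    also have "\<dots> \<le> M * B" using energy_le[OF x] M(1) by (rule mult_left_mono)
    finally have "\<bar>U n x \<xi>\<bar> \<le> sqrt (M * B)" by (simp add: real_le_rsqrt)
    then show ?thesis by (simp add: N_def \<open>j = n\<close>)
  qed
  define A where "A = \<bar>\<kappa>\<bar> * N"
  have A0: "0 \<le> A" by (simp add: A_def N0)
  have lip1: "\<bar>U j x \<xi> - U j x' \<xi>\<bar> \<le> A * \<bar>x - x'\<bar>"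
    if "j < n" and x: "{x, x', \<xi>} \<subseteq> {0<..T}" for j x x' \<xi>
  proof -
    have "norm (U j x \<xi> - U j x' \<xi>) \<le> A * norm (x - x')"
    proof (rule field_differentiable_bound[of "{0<..T}"])
      fix z assume z: "z \<in> {0<..T}"
      then show "((\<lambda>x. U j x \<xi>) has_field_derivative \<kappa> * U (Suc j) z \<xi>) (at z within {0<..T})"
        using chainD(1)[OF U[of \<xi>], of z j] that by (auto intro: has_field_derivative_at_within)
      show "norm (\<kappa> * U (Suc j) z \<xi>) \<le> A"
        unfolding A_def using bounded[of "Suc j" z \<xi>] that z by (auto simp: abs_mult intro!: mult_left_mono)
    qed (use x in auto)
    then show ?thesis by simp
  qed
  have lip2: "\<bar>U j x \<xi> - U j x \<xi>'\<bar> \<le> sqrt (B * n) * A * \<bar>\<xi> - \<xi>'\<bar>"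
    if "j < n" and x: "{x, \<xi>, \<xi>'} \<subseteq> {0<..T}" for j x \<xi> \<xi>'
  proof -
    define w where "w = (\<lambda>j x. U j x \<xi> - U j x \<xi>')"
    have w: "chain (\<lambda>_. 0) w"
      unfolding w_def using chain_diff[OF U U, of \<xi> \<xi>'] x by auto
    \<comment> \<open>Both solutions have the same data on their diagonals, so
      \<open>U j \<xi>' \<xi>'\<close> may be replaced by \<open>U j \<xi> \<xi>\<close>. This turns
      a change of the parameter into a change of x with \<xi> fixed, which \<open>lip1\<close>
      covers.\<close>
    have "energy w \<xi>' = (\<Sum>j<n. (U j \<xi>' \<xi> - U j \<xi> \<xi>)\<^sup>2)"
      unfolding energy_def w_def using x by (intro sum.cong) (auto simp: diag)
    also have "\<dots> \<le> (\<Sum>j<n. (A * \<bar>\<xi> - \<xi>'\<bar>)\<^sup>2)"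
    proof (rule sum_mono)
      fix j assume "j \<in> {..<n}"
      then show "(U j \<xi>' \<xi> - U j \<xi> \<xi>)\<^sup>2 \<le> (A * \<bar>\<xi> - \<xi>'\<bar>)\<^sup>2"
        using lip1[of j \<xi>' \<xi> \<xi>] x power_mono[of "\<bar>U j \<xi>' \<xi> - U j \<xi> \<xi>\<bar>" "A * \<bar>\<xi> - \<xi>'\<bar>" 2]
        by (auto simp: abs_minus_commute)
    qed
    finally have "energy w \<xi>' \<le> n * (A * \<bar>\<xi> - \<xi>'\<bar>)\<^sup>2" by simp
    then have "B * energy w \<xi>' \<le> B * (n * (A * \<bar>\<xi> - \<xi>'\<bar>)\<^sup>2)"
      using B(1) by (simp add: mult_left_mono)
    with B(2)[OF w, of x \<xi>'] x have "energy w x \<le> B * n * (A * \<bar>\<xi> - \<xi>'\<bar>)\<^sup>2"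
      by (simp add: mult.assoc)
    then have "sqrt (energy w x) \<le> sqrt (B * n * (A * \<bar>\<xi> - \<xi>'\<bar>)\<^sup>2)"
      by (rule real_sqrt_le_mono)
    also have "\<dots> = sqrt (B * n) * A * \<bar>\<xi> - \<xi>'\<bar>"
      using A0 by (simp add: real_sqrt_mult)
    finally show ?thesis
      using abs_le_sqrt_energy[OF that(1), of w x] by (simp add: w_def)
  qed
  define \<Lambda> where "\<Lambda> = max A (sqrt (B * n) * A)"
  show thesis
  proof (rule that[of \<Lambda>])
    show "0 \<le> \<Lambda>" using A0 by (simp add: \<Lambda>_def)
    fix j x x' \<xi> \<xi>' assume j: "j < n" and x: "{x, x', \<xi>, \<xi>'} \<subseteq> {0<..T}"
    have "\<bar>U j x \<xi> - U j x' \<xi>\<bar> \<le> \<Lambda> * \<bar>x - x'\<bar>"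
      using lip1[of j x x' \<xi>] j x mult_right_mono[of A \<Lambda> "\<bar>x - x'\<bar>"] by (auto simp: \<Lambda>_def)
    moreover have "\<bar>U j x' \<xi> - U j x' \<xi>'\<bar> \<le> \<Lambda> * \<bar>\<xi> - \<xi>'\<bar>"
      using lip2[of j x' \<xi> \<xi>'] j x mult_right_mono[of "sqrt (B * n) * A" \<Lambda> "\<bar>\<xi> - \<xi>'\<bar>"]
      by (auto simp: \<Lambda>_def)
    ultimately show "\<bar>U j x \<xi> - U j x' \<xi>'\<bar> \<le> \<Lambda> * (\<bar>x - x'\<bar> + \<bar>\<xi> - \<xi>'\<bar>)"
      unfolding distrib_left by linarith
  qed
qed

end

subsection \<open>Functions on the half-line and the quadrant\<close>

lemma tendsto_at_right_0_if_continuous_on: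
  fixes f :: "real \<Rightarrow> real"
  assumes "continuous_on {0..} f"
  shows "(f \<longlongrightarrow> f 0) (at_right 0)"
proof -
  have "(f \<longlongrightarrow> f 0) (at 0 within {0..})"
    using assms by (simp add: continuous_on_def)
  then show ?thesis
    by (rule tendsto_within_subset) auto
qed

text \<open>The device for carrying identities from the open quadrant, where \<open>V\<close>
  determines the functions, to the axes.\<close>

lemma halfline_eqI:
  fixes f g :: "real \<Rightarrow> real"
  assumes "continuous_on {0..} f" "continuous_on {0..} g"
    and eq: "\<And>x. 0 < x \<Longrightarrow> f x = g x" and "0 \<le> x"
  shows "f x = g x"
proof (cases "x = 0")
  case True
  have "\<forall>\<^sub>F x in at_right 0. f x = g x"
    using eq by (auto simp: eventually_at_right_field intro!: exI[of _ 1])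
  then have "(g \<longlongrightarrow> f 0) (at_right 0)"
    using tendsto_at_right_0_if_continuous_on[OF assms(1)] by (rule Lim_transform_eventually[rotated])
  with tendsto_at_right_0_if_continuous_on[OF assms(2)] True show ?thesis
    by (metis tendsto_unique trivial_limit_at_right_real)
qed (use assms in auto)

lemma continuous_on_quadrant_sections:
  fixes h :: "real \<Rightarrow> real \<Rightarrow> real"
  assumes "continuous_on ({0..} \<times> {0..}) (\<lambda>(x, \<xi>). h x \<xi>)"
  shows "0 \<le> \<xi> \<Longrightarrow> continuous_on {0..} (\<lambda>x. h x \<xi>)" "0 \<le> x \<Longrightarrow> continuous_on {0..} (h x)"
    "continuous_on {0..} (\<lambda>x. h x x)"
proof -
  have *: "continuous_on {0..} (\<lambda>x. h (p x) (q x))"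
    if "continuous_on {0..} p" "continuous_on {0..} q" "\<And>x. 0 \<le> x \<Longrightarrow> 0 \<le> p x \<and> 0 \<le> q x"
    for p q :: "real \<Rightarrow> real"
    using continuous_on_compose2[OF assms continuous_on_Pair[OF that(1,2)]] that(3) by fastforce
  show "0 \<le> \<xi> \<Longrightarrow> continuous_on {0..} (\<lambda>x. h x \<xi>)" "0 \<le> x \<Longrightarrow> continuous_on {0..} (h x)"
    "continuous_on {0..} (\<lambda>x. h x x)"
    using *[of id "\<lambda>_. \<xi>"] *[of "\<lambda>_. x" id] *[of id id] by simp_all
qed

text \<open>The Lipschitz constants hold on squares that reach up to the axes, so the values of F
  along any sequence of interior points tending to a boundary point form a Cauchy sequence. Shifting
  both coordinates by the same small amount treats the two axes, the corner and the interior
  alike.\<close>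

lemma quadrant_extension:
  fixes F :: "real \<Rightarrow> real \<Rightarrow> real"
  assumes lip: "\<And>T. \<exists>\<Lambda>\<ge>0. \<forall>x x' \<xi> \<xi>'. {x, x', \<xi>, \<xi>'} \<subseteq> {0<..T} \<longrightarrow>
    \<bar>F x \<xi> - F x' \<xi>'\<bar> \<le> \<Lambda> * (\<bar>x - x'\<bar> + \<bar>\<xi> - \<xi>'\<bar>)"
  obtains G where "continuous_on ({0..} \<times> {0..}) (\<lambda>(x, \<xi>). G x \<xi>)"
    "\<And>x \<xi>. 0 < x \<Longrightarrow> 0 < \<xi> \<Longrightarrow> G x \<xi> = F x \<xi>"
proof -
  \<comment> \<open>The shifts lie in (0, 1], so the shifted points stay in the open quadrant and
    within a square enlarged by 1.\<close>
  define e where "e k = inverse (real (Suc k))" for k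
  have e0: "e \<longlonglongrightarrow> 0" unfolding e_def by (rule LIMSEQ_inverse_real_of_nat)
  have e1: "0 < e k" "e k \<le> 1" for k by (auto simp: e_def field_simps)
  define S where "S x \<xi> k = F (x + e k) (\<xi> + e k)" for x \<xi> k
  define G where "G x \<xi> = lim (S x \<xi>)" for x \<xi>
  have lim: "S x \<xi> \<longlonglongrightarrow> G x \<xi>" if "0 \<le> x" "0 \<le> \<xi>" for x \<xi>
  proof -
    obtain \<Lambda> where \<Lambda>: "0 \<le> \<Lambda>" "\<And>x1 x' \<xi>1 \<xi>'. {x1, x', \<xi>1, \<xi>'} \<subseteq> {0<..x + \<xi> + 1} \<Longrightarrow>
      \<bar>F x1 \<xi>1 - F x' \<xi>'\<bar> \<le> \<Lambda> * (\<bar>x1 - x'\<bar> + \<bar>\<xi>1 - \<xi>'\<bar>)"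
      using lip[of "x + \<xi> + 1"] by blast
    have dS: "\<bar>S x \<xi> k - S x \<xi> m\<bar> \<le> (2 * \<Lambda>) * \<bar>e k - e m\<bar>" for k m
      using \<Lambda>(2)[of "x + e k" "x + e m" "\<xi> + e k" "\<xi> + e m"] that e1[of k] e1[of m]
      unfolding S_def by auto
    have "Cauchy (S x \<xi>)"
      unfolding Cauchy_def
    proof (intro allI impI)
      fix d :: real assume "0 < d"
      \<comment> \<open>The added 1 keeps the denominator positive when \<Lambda> = 0.\<close>
      then have "0 < d / (2 * \<Lambda> + 1)" using \<Lambda>(1) by simp
      then obtain M where M: "\<forall>m\<ge>M. \<forall>k\<ge>M. dist (e m) (e k) < d / (2 * \<Lambda> + 1)"
        using LIMSEQ_imp_Cauchy[OF e0] unfolding Cauchy_def by blast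
      have "dist (S x \<xi> m) (S x \<xi> k) < d" if "M \<le> m" "M \<le> k" for m k
      proof -
        have "\<bar>S x \<xi> m - S x \<xi> k\<bar> \<le> (2 * \<Lambda> + 1) * \<bar>e m - e k\<bar>"
          using dS[of m k] by (simp add: distrib_right)
        also have "\<dots> < d"
          using M that \<Lambda>(1) by (simp add: dist_real_def pos_less_divide_eq mult.commute)
        finally show ?thesis by (simp add: dist_real_def)
      qed
      then show "\<exists>M. \<forall>m\<ge>M. \<forall>k\<ge>M. dist (S x \<xi> m) (S x \<xi> k) < d" by blast
    qed
    then show ?thesis
      unfolding G_def using Cauchy_convergent_iff convergent_LIMSEQ_iff by blast
  qed
  have G_lip: "\<exists>\<Lambda>\<ge>0. \<forall>x x' \<xi> \<xi>'. {x, x', \<xi>, \<xi>'} \<subseteq> {0..T} \<longrightarrow>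
      \<bar>G x \<xi> - G x' \<xi>'\<bar> \<le> \<Lambda> * (\<bar>x - x'\<bar> + \<bar>\<xi> - \<xi>'\<bar>)" for T
  proof -
    obtain \<Lambda> where \<Lambda>: "0 \<le> \<Lambda>" "\<And>x x' \<xi> \<xi>'. {x, x', \<xi>, \<xi>'} \<subseteq> {0<..T + 1} \<Longrightarrow>
      \<bar>F x \<xi> - F x' \<xi>'\<bar> \<le> \<Lambda> * (\<bar>x - x'\<bar> + \<bar>\<xi> - \<xi>'\<bar>)"
      using lip[of "T + 1"] by blast
    have "\<bar>G x \<xi> - G x' \<xi>'\<bar> \<le> \<Lambda> * (\<bar>x - x'\<bar> + \<bar>\<xi> - \<xi>'\<bar>)" if "{x, x', \<xi>, \<xi>'} \<subseteq> {0..T}" for x x' \<xi> \<xi>'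
    proof (rule LIMSEQ_le_const2)
      show "(\<lambda>k. \<bar>S x \<xi> k - S x' \<xi>' k\<bar>) \<longlonglongrightarrow> \<bar>G x \<xi> - G x' \<xi>'\<bar>"
        using that by (intro tendsto_intros lim) auto
      have "\<bar>S x \<xi> k - S x' \<xi>' k\<bar> \<le> \<Lambda> * (\<bar>x - x'\<bar> + \<bar>\<xi> - \<xi>'\<bar>)" for k
        using \<Lambda>(2)[of "x + e k" "x' + e k" "\<xi> + e k" "\<xi>' + e k"] e1[of k] that
        unfolding S_def by auto
      then show "\<exists>N. \<forall>k\<ge>N. \<bar>S x \<xi> k - S x' \<xi>' k\<bar> \<le> \<Lambda> * (\<bar>x - x'\<bar> + \<bar>\<xi> - \<xi>'\<bar>)" by blast
    qed
    with \<Lambda>(1) show ?thesis by blast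
  qed
  show thesis
  proof (rule that)
    show "continuous_on ({0..} \<times> {0..}) (\<lambda>(x, \<xi>). G x \<xi>)"
      unfolding continuous_on_def
    proof (clarsimp)
      fix x \<xi> :: real assume x: "0 \<le> x" "0 \<le> \<xi>"
      \<comment> \<open>T exceeds both coordinates strictly, so nearby points of the quadrant remain
        in the square where one constant is valid.\<close>
      define T where "T = x + \<xi> + 1"
      obtain \<Lambda> where \<Lambda>: "0 \<le> \<Lambda>" "\<And>x x' \<xi> \<xi>'. {x, x', \<xi>, \<xi>'} \<subseteq> {0..T} \<Longrightarrow>
        \<bar>G x \<xi> - G x' \<xi>'\<bar> \<le> \<Lambda> * (\<bar>x - x'\<bar> + \<bar>\<xi> - \<xi>'\<bar>)"
        using G_lip[of T] by blast
      let ?F = "at (x, \<xi>) within {0..} \<times> {0..}"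
      have fst: "(fst \<longlongrightarrow> x) ?F" and snd: "(snd \<longlongrightarrow> \<xi>) ?F"
        using tendsto_fst[OF tendsto_ident_at[of "(x, \<xi>)" "{0..} \<times> {0..}"]]
          tendsto_snd[OF tendsto_ident_at[of "(x, \<xi>)" "{0..} \<times> {0..}"]] by (simp_all add: eta_contract_eq)
      have "((\<lambda>z. \<Lambda> * (\<bar>fst z - x\<bar> + \<bar>snd z - \<xi>\<bar>)) \<longlongrightarrow> \<Lambda> * (\<bar>x - x\<bar> + \<bar>\<xi> - \<xi>\<bar>)) ?F"
        by (intro tendsto_intros fst snd)
      then have "((\<lambda>z. \<Lambda> * (\<bar>fst z - x\<bar> + \<bar>snd z - \<xi>\<bar>)) \<longlongrightarrow> 0) ?F" by simp
      moreover have "\<forall>\<^sub>F z in ?F. z \<in> {0..} \<times> {0..}"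
        by (simp add: eventually_at_filter)
      moreover have "\<forall>\<^sub>F z in ?F. fst z < T" "\<forall>\<^sub>F z in ?F. snd z < T"
        using order_tendstoD(2)[OF fst, of T] order_tendstoD(2)[OF snd, of T] x by (auto simp: T_def)
      then have "\<forall>\<^sub>F z in ?F. norm (G (fst z) (snd z) - G x \<xi>) \<le> \<Lambda> * (\<bar>fst z - x\<bar> + \<bar>snd z - \<xi>\<bar>)"
        using calculation(2)
      proof eventually_elim
        case (elim z)
        then show ?case
          using \<Lambda>(2)[of "fst z" x "snd z" \<xi>] x by (auto simp: T_def mem_Times_iff)
      qed
      ultimately have "((\<lambda>z. G (fst z) (snd z) - G x \<xi>) \<longlongrightarrow> 0) ?F"
        by (elim Lim_null_comparison[rotated])
      then show "((\<lambda>(x, \<xi>). G x \<xi>) \<longlongrightarrow> G x \<xi>) ?F"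
        by (simp add: LIM_zero_iff case_prod_unfold)
    qed
  next
    fix x \<xi> :: real assume x: "0 < x" "0 < \<xi>"
    obtain \<Lambda> where \<Lambda>: "0 \<le> \<Lambda>" "\<And>x1 x' \<xi>1 \<xi>'. {x1, x', \<xi>1, \<xi>'} \<subseteq> {0<..x + \<xi> + 1} \<Longrightarrow>
      \<bar>F x1 \<xi>1 - F x' \<xi>'\<bar> \<le> \<Lambda> * (\<bar>x1 - x'\<bar> + \<bar>\<xi>1 - \<xi>'\<bar>)"
      using lip[of "x + \<xi> + 1"] by blast
    have "norm (S x \<xi> k - F x \<xi>) \<le> 2 * \<Lambda> * e k" for k
      using \<Lambda>(2)[of "x + e k" x "\<xi> + e k" \<xi>] x e1[of k] unfolding S_def by auto
    moreover have "(\<lambda>k. 2 * \<Lambda> * e k) \<longlonglongrightarrow> 0"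
      using tendsto_mult_right_zero[OF e0] .
    ultimately have "(\<lambda>k. S x \<xi> k - F x \<xi>) \<longlonglongrightarrow> 0"
      by (intro Lim_null_comparison[of "\<lambda>k. S x \<xi> k - F x \<xi>" "\<lambda>k. 2 * \<Lambda> * e k"]) auto
    then have "S x \<xi> \<longlonglongrightarrow> F x \<xi>" by (rule LIM_zero_cancel)
    with lim[of x \<xi>] x show "G x \<xi> = F x \<xi>" by (metis LIMSEQ_unique less_imp_le)
  qed
qed

lemma integral_has_derivative_halfline:
  fixes g :: "real \<Rightarrow> real"
  assumes "continuous_on {0..} g" "0 \<le> x"
  shows "((\<lambda>x. integral {0..x} g) has_real_derivative g x) (at x within {0..})"
proof -
  have "((\<lambda>x. integral {0..x} g) has_real_derivative g x) (at x within {0..x + 1})"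
    using assms by (intro integral_has_real_derivative continuous_on_subset[OF assms(1)]) auto
  moreover have "at x within {0..x + 1} = at x within {0..}"
    by (rule at_within_nhd[of _ "{..<x + 1}"]) auto
  ultimately show ?thesis by simp
qed

lemma leibniz_fixed:
  fixes h h' :: "real \<Rightarrow> real \<Rightarrow> real"
  assumes h: "continuous_on ({0..} \<times> {0..}) (\<lambda>(x, \<xi>). h x \<xi>)"
    and h': "continuous_on ({0..} \<times> {0..}) (\<lambda>(x, \<xi>). h' x \<xi>)"
    and deriv: "\<And>x \<xi>. 0 \<le> x \<Longrightarrow> 0 \<le> \<xi> \<Longrightarrow> ((\<lambda>x. h x \<xi>) has_real_derivative h' x \<xi>) (at x within {0..})"
    and "0 \<le> x"
  shows "((\<lambda>x. integral {0..a} (h x)) has_real_derivative integral {0..a} (h' x)) (at x within {0..})"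
proof -
  have "((\<lambda>x. integral (cbox 0 a) (h x)) has_real_derivative integral (cbox 0 a) (h' x)) (at x within {0..})"
  proof (rule leibniz_rule_field_derivative)
    fix x :: real assume "x \<in> {0..}"
    then show "h x integrable_on cbox 0 a"
      by (intro integrable_continuous continuous_on_subset[OF continuous_on_quadrant_sections(2)[OF h, of x]]) auto
  next
    show "continuous_on ({0..} \<times> cbox 0 a) (\<lambda>(x, \<xi>). h' x \<xi>)"
      by (rule continuous_on_subset[OF h']) auto
  qed (use deriv assms in auto)
  then show ?thesis by simp
qed

text \<open>The upper limit and the parameter are first treated as independent variables u and v.
  The function of two variables is differentiable because one partial derivative is continuous, and
  the chain rule along the diagonal adds the two contributions. Everything is relative to the closed
  quadrant, so x = 0 is included.\<close>

lemma leibniz_moving: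
  fixes h h' :: "real \<Rightarrow> real \<Rightarrow> real"
  assumes h: "continuous_on ({0..} \<times> {0..}) (\<lambda>(x, \<xi>). h x \<xi>)"
    and h': "continuous_on ({0..} \<times> {0..}) (\<lambda>(x, \<xi>). h' x \<xi>)"
    and deriv: "\<And>x \<xi>. 0 \<le> x \<Longrightarrow> 0 \<le> \<xi> \<Longrightarrow> ((\<lambda>x. h x \<xi>) has_real_derivative h' x \<xi>) (at x within {0..})"
    and x: "0 \<le> x"
  shows "((\<lambda>x. integral {0..x} (h x)) has_real_derivative h x x + integral {0..x} (h' x)) (at x within {0..})"
proof -
  let ?P = "\<lambda>(u, v). integral {0..v} (h u)"
  have "(?P has_derivative (\<lambda>(tx, ty). integral {0..x} (h' x) * tx + blinfun_mult_right (h x x) ty))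
      (at (x, x) within {0..} \<times> {0..})"
  proof (rule has_derivative_partialsI[where fy = "\<lambda>u v. blinfun_mult_right (h u v)"])
    show "((\<lambda>u. integral {0..x} (h u)) has_derivative (*) (integral {0..x} (h' x))) (at x within {0..})"
      using leibniz_fixed[OF assms] by (simp add: has_field_derivative_def)
  next
    fix u v :: real assume "u \<in> {0..}" "v \<in> {0..}"
    then show "((\<lambda>v. integral {0..v} (h u)) has_derivative blinfun_mult_right (h u v)) (at v within {0..})"
      using integral_has_derivative_halfline[OF continuous_on_quadrant_sections(2)[OF h], of u v]
      by (simp add: has_field_derivative_def)
  next
    have "continuous_on ({0..} \<times> {0..}) (\<lambda>z. blinfun_mult_right ((\<lambda>(u, v). h u v) z))"
      by (intro continuous_intros h bounded_linear.continuous_on[OF bounded_linear_blinfun_mult_right])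
    then show "continuous (at (x, x) within {0..} \<times> {0..}) (\<lambda>(u, v). blinfun_mult_right (h u v))"
      using x by (simp add: continuous_on_eq_continuous_within case_prod_unfold)
  qed (use x in auto)
  then have "(?P has_derivative (\<lambda>(tx, ty). integral {0..x} (h' x) * tx + blinfun_mult_right (h x x) ty))
      (at (x, x) within (\<lambda>x. (x, x)) ` {0..})"
    by (rule has_derivative_subset) auto
  from has_derivative_in_compose[where f = "\<lambda>x. (x, x)",
      OF has_derivative_Pair[OF has_derivative_ident has_derivative_ident] this]
  have "((\<lambda>x. ?P (x, x)) has_derivative (\<lambda>d. integral {0..x} (h' x) * d + h x x * d)) (at x within {0..})"
    by simp
  then show ?thesis
    by (auto simp: has_field_derivative_def fun_eq_iff algebra_simps elim!: has_derivative_eq_rhs)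
qed

subsection \<open>Continuous propagator and Duhamel formula\<close>

context linear_chain
begin

text \<open>The differential equations are known only in the open quadrant, and derivatives do not
  pass to limits by themselves. Their integrated form does: both sides are continuous in \<xi>, so
  it holds for \<xi> = 0 as well, and differentiating it back gives one-sided derivatives on the
  axes.\<close>

lemma propagator_extension:
  fixes U :: "nat \<Rightarrow> real \<Rightarrow> real \<Rightarrow> real"
  assumes U: "\<And>\<xi>. 0 < \<xi> \<Longrightarrow> chain (\<lambda>_. 0) (\<lambda>j x. U j x \<xi>)"
    and diag: "\<And>j \<xi>. j < n \<Longrightarrow> 0 < \<xi> \<Longrightarrow> U j \<xi> \<xi> = (if j = n - 1 then 1 else 0)"
  obtains W where
    "\<And>j. j \<le> n \<Longrightarrow> continuous_on ({0..} \<times> {0..}) (\<lambda>(x, \<xi>). W j x \<xi>)"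
    "\<And>j x \<xi>. j < n \<Longrightarrow> 0 < x \<Longrightarrow> 0 < \<xi> \<Longrightarrow> W j x \<xi> = U j x \<xi>"
    "\<And>j \<xi>. j < n \<Longrightarrow> 0 \<le> \<xi> \<Longrightarrow> W j \<xi> \<xi> = (if j = n - 1 then 1 else 0)"
    "\<And>x \<xi>. 0 \<le> x \<Longrightarrow> 0 \<le> \<xi> \<Longrightarrow> W n x \<xi> = - (\<Sum>j=1..n. R j x * W (n - j) x \<xi>)"
    "\<And>j x \<xi>. j < n \<Longrightarrow> 0 \<le> x \<Longrightarrow> 0 \<le> \<xi> \<Longrightarrow>
       ((\<lambda>x. W j x \<xi>) has_real_derivative \<kappa> * W (Suc j) x \<xi>) (at x within {0..})"
proof -
  have "\<exists>G. continuous_on ({0..} \<times> {0..}) (\<lambda>(x, \<xi>). G x \<xi>) \<and> (\<forall>x>0. \<forall>\<xi>>0. G x \<xi> = U j x \<xi>)"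
    if "j < n" for j
  proof (rule quadrant_extension[of "U j"])
    show "\<exists>\<Lambda>\<ge>0. \<forall>x x' \<xi> \<xi>'. {x, x', \<xi>, \<xi>'} \<subseteq> {0<..T} \<longrightarrow>
        \<bar>U j x \<xi> - U j x' \<xi>'\<bar> \<le> \<Lambda> * (\<bar>x - x'\<bar> + \<bar>\<xi> - \<xi>'\<bar>)" for T
      using propagator_lipschitz[OF U diag, of T] that by metis
  qed blast
  then obtain W0 where W0: "\<And>j. j < n \<Longrightarrow> continuous_on ({0..} \<times> {0..}) (\<lambda>(x, \<xi>). W0 j x \<xi>)"
    "\<And>j x \<xi>. j < n \<Longrightarrow> 0 < x \<Longrightarrow> 0 < \<xi> \<Longrightarrow> W0 j x \<xi> = U j x \<xi>"
    by metis
  \<comment> \<open>The Lipschitz estimate covers only j < n; the top component is extended by the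
    equation instead.\<close>
  define W where "W j x \<xi> = (if j < n then W0 j x \<xi> else - (\<Sum>j=1..n. R j x * W0 (n - j) x \<xi>))"
    for j x \<xi>
  have cont: "continuous_on ({0..} \<times> {0..}) (\<lambda>(x, \<xi>). W j x \<xi>)" if "j \<le> n" for j
  proof (cases "j < n")
    case False
    have "continuous_on ({0..} \<times> {0..}) (\<lambda>z. - (\<Sum>j=1..n. R j (fst z) * (\<lambda>(x, \<xi>). W0 (n - j) x \<xi>) z))"
      by (intro continuous_intros W0(1) continuous_on_compose2[OF R_cont continuous_on_fst]) auto
    then show ?thesis using False by (simp add: W_def case_prod_unfold)
  qed (simp add: W_def W0)
  have W_top: "W n x \<xi> = - (\<Sum>j=1..n. R j x * W (n - j) x \<xi>)" for x \<xi>
    by (auto simp: W_def intro!: sum.cong)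
  have W_U: "W j x \<xi> = U j x \<xi>" if "j \<le> n" "0 < x" "0 < \<xi>" for j x \<xi>
  proof (cases "j < n")
    case False
    with that chainD(2)[OF U[of \<xi>], of x] show ?thesis
      by (auto simp: W_def W0 intro!: sum.cong)
  qed (simp add: W_def W0 that)
  have W_diag: "W j \<xi> \<xi> = (if j = n - 1 then 1 else 0)" if "j < n" "0 \<le> \<xi>" for j \<xi>
    by (rule halfline_eqI[OF continuous_on_quadrant_sections(3)[OF cont] _ _ that(2)])
      (use that W_U diag in auto)
  have W_int: "W j x \<xi> = W j 0 \<xi> + \<kappa> * integral {0..x} (\<lambda>\<sigma>. W (Suc j) \<sigma> \<xi>)"
    if "j < n" "0 \<le> x" "0 \<le> \<xi>" for j x \<xi>
  proof (rule halfline_eqI[OF _ _ _ that(3)])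
    show "continuous_on {0..} (W j x)"
      using continuous_on_quadrant_sections(2)[OF cont] that by simp
    \<comment> \<open>The pair is swapped because here \<xi> is the parameter and the first argument
      of \<open>W\<close> is integrated.\<close>
    have "continuous_on ({0..} \<times> cbox 0 x) (\<lambda>z. (\<lambda>(x, \<xi>). W (Suc j) x \<xi>) (snd z, fst z))"
      using that by (intro continuous_on_compose2[OF cont[of "Suc j"]] continuous_intros) auto
    then have "continuous_on {0..} (\<lambda>\<xi>. integral (cbox 0 x) (\<lambda>\<sigma>. W (Suc j) \<sigma> \<xi>))"
      by (intro integral_continuous_on_param) (simp add: case_prod_unfold)
    then show "continuous_on {0..} (\<lambda>\<xi>. W j 0 \<xi> + \<kappa> * integral {0..x} (\<lambda>\<sigma>. W (Suc j) \<sigma> \<xi>))"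
      using continuous_on_quadrant_sections(2)[OF cont, of j 0] that
      by (auto intro!: continuous_intros)
    fix \<xi> :: real assume \<xi>: "0 < \<xi>"
    \<comment> \<open>Nothing is known yet about the derivative at \<sigma> = 0; this form of the
      fundamental theorem asks only for continuity there.\<close>
    have "((\<lambda>\<sigma>. \<kappa> * W (Suc j) \<sigma> \<xi>) has_integral W j x \<xi> - W j 0 \<xi>) {0..x}"
    proof (rule fundamental_theorem_of_calculus_interior[OF that(2)])
      show "continuous_on {0..x} (\<lambda>x. W j x \<xi>)"
        using continuous_on_quadrant_sections(1)[OF cont, of j \<xi>] that \<xi> by (auto intro: continuous_on_subset)
      fix \<sigma> assume "\<sigma> \<in> {0<..<x}"
      then have \<sigma>: "0 < \<sigma>" by simp
      have "((\<lambda>x. U j x \<xi>) has_real_derivative \<kappa> * W (Suc j) \<sigma> \<xi>) (at \<sigma>)"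
        using chainD(1)[OF U[OF \<xi>] \<sigma> that(1)] W_U \<sigma> \<xi> that by simp
      then have "((\<lambda>x. W j x \<xi>) has_real_derivative \<kappa> * W (Suc j) \<sigma> \<xi>) (at \<sigma>)"
        by (rule has_field_derivative_transform_within_open[where S = "{0<..}"]) (use \<sigma> \<xi> that W_U in auto)
      then show "((\<lambda>x. W j x \<xi>) has_vector_derivative \<kappa> * W (Suc j) \<sigma> \<xi>) (at \<sigma>)"
        by (simp add: has_real_derivative_iff_has_vector_derivative)
    qed
    then show "W j x \<xi> = W j 0 \<xi> + \<kappa> * integral {0..x} (\<lambda>\<sigma>. W (Suc j) \<sigma> \<xi>)"
      by (simp add: integral_unique flip: integral_mult_right)
  qed
  have W_deriv: "((\<lambda>x. W j x \<xi>) has_real_derivative \<kappa> * W (Suc j) x \<xi>) (at x within {0..})"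
    if "j < n" "0 \<le> x" "0 \<le> \<xi>" for j x \<xi>
  proof (rule has_field_derivative_transform_within[where d = 1])
    show "((\<lambda>x. W j 0 \<xi> + \<kappa> * integral {0..x} (\<lambda>\<sigma>. W (Suc j) \<sigma> \<xi>)) has_real_derivative
        \<kappa> * W (Suc j) x \<xi>) (at x within {0..})"
      using that integral_has_derivative_halfline[OF continuous_on_quadrant_sections(1)[OF cont[of "Suc j"]], of \<xi> x]
      by (auto intro!: derivative_eq_intros)
    show "W j 0 \<xi> + \<kappa> * integral {0..x'} (\<lambda>\<sigma>. W (Suc j) \<sigma> \<xi>) = W j x' \<xi>" if "x' \<in> {0..}" for x'
      using W_int[of j x' \<xi>] \<open>j < n\<close> \<open>0 \<le> \<xi>\<close> that by simp
  qed (use that in auto)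
  show thesis
  proof (rule that[of W])
    show "W n x \<xi> = - (\<Sum>j=1..n. R j x * W (n - j) x \<xi>)" for x \<xi>
      by (rule W_top)
    show "W j \<xi> \<xi> = (if j = n - 1 then 1 else 0)" if "j < n" "0 \<le> \<xi>" for j \<xi>
      by (rule W_diag[OF that])
  qed (simp_all add: cont W_U W_deriv)
qed

text \<open>Variation of constants. Differentiating the integral produces the boundary term
  \<open>W j x x * g x\<close>, which vanishes for j < n - 1 and equals \<open>g x\<close> for j = n
  - 1; this is the summand reserved for j = n. Writing the integral from a to x as a difference of
  integrals from 0 allows x < a.\<close>

lemma duhamel_chain:
  fixes W :: "nat \<Rightarrow> real \<Rightarrow> real \<Rightarrow> real" and g :: "real \<Rightarrow> real" and a :: real
  assumes cont: "\<And>j. j \<le> n \<Longrightarrow> continuous_on ({0..} \<times> {0..}) (\<lambda>(x, \<xi>). W j x \<xi>)"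
    and diag: "\<And>j \<xi>. j < n \<Longrightarrow> 0 \<le> \<xi> \<Longrightarrow> W j \<xi> \<xi> = (if j = n - 1 then 1 else 0)"
    and top: "\<And>x \<xi>. 0 \<le> x \<Longrightarrow> 0 \<le> \<xi> \<Longrightarrow> W n x \<xi> = - (\<Sum>j=1..n. R j x * W (n - j) x \<xi>)"
    and deriv: "\<And>j x \<xi>. j < n \<Longrightarrow> 0 \<le> x \<Longrightarrow> 0 \<le> \<xi> \<Longrightarrow>
       ((\<lambda>x. W j x \<xi>) has_real_derivative \<kappa> * W (Suc j) x \<xi>) (at x within {0..})"
    and g: "continuous_on {0..} g"
  defines "u \<equiv> \<lambda>j x. \<kappa> * (integral {0..x} (\<lambda>\<xi>. W j x \<xi> * g \<xi>) - integral {0..a} (\<lambda>\<xi>. W j x \<xi> * g \<xi>))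
                     + (if j = n then g x else 0)"
  shows "\<And>j x. j < n \<Longrightarrow> 0 \<le> x \<Longrightarrow> (u j has_real_derivative \<kappa> * u (Suc j) x) (at x within {0..})"
    and "\<And>x. 0 \<le> x \<Longrightarrow> u n x = g x - (\<Sum>j=1..n. R j x * u (n - j) x)"
proof -
  have Wg: "continuous_on ({0..} \<times> {0..}) (\<lambda>(x, \<xi>). W j x \<xi> * g \<xi>)" if "j \<le> n" for j
  proof -
    have "continuous_on ({0..} \<times> {0..}) (\<lambda>z. (\<lambda>(x, \<xi>). W j x \<xi>) z * g (snd z))"
      using that by (intro continuous_intros cont continuous_on_compose2[OF g]) auto
    then show ?thesis by (simp add: case_prod_unfold)
  qed
  show "(u j has_real_derivative \<kappa> * u (Suc j) x) (at x within {0..})" if "j < n" "0 \<le> x" for j x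
  proof -
    have d: "((\<lambda>x. W j x \<xi> * g \<xi>) has_real_derivative \<kappa> * (W (Suc j) x \<xi> * g \<xi>)) (at x within {0..})"
      if "0 \<le> x" "0 \<le> \<xi>" for x \<xi>
      using deriv[OF \<open>j < n\<close> that] by (auto intro!: derivative_eq_intros)
    have c: "continuous_on ({0..} \<times> {0..}) (\<lambda>(x, \<xi>). \<kappa> * (W (Suc j) x \<xi> * g \<xi>))"
      using continuous_on_mult_left[OF Wg[of "Suc j"], of \<kappa>] that by (simp add: case_prod_unfold)
    show ?thesis
      unfolding u_def
      using that leibniz_moving[OF Wg c d, of x] leibniz_fixed[OF Wg c d, of x a] diag[of j x]
      by (auto intro!: derivative_eq_intros simp: algebra_simps)
  qed
  show "u n x = g x - (\<Sum>j=1..n. R j x * u (n - j) x)" if "0 \<le> x" for x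
  proof -
    have "integral {0..b} (\<lambda>\<xi>. W n x \<xi> * g \<xi>) = - (\<Sum>j=1..n. R j x * integral {0..b} (\<lambda>\<xi>. W (n - j) x \<xi> * g \<xi>))"
      for b
    proof -
      have int: "(\<lambda>\<xi>. W j x \<xi> * g \<xi>) integrable_on {0..b}" if "j \<le> n" for j
        using continuous_on_subset[OF continuous_on_quadrant_sections(2)[OF Wg[OF that] \<open>0 \<le> x\<close>], of "{0..b}"]
        by (intro integrable_continuous_real) auto
      have "integral {0..b} (\<lambda>\<xi>. W n x \<xi> * g \<xi>) =
          integral {0..b} (\<lambda>\<xi>. - (\<Sum>j=1..n. R j x * (W (n - j) x \<xi> * g \<xi>)))"
        using top[OF that] by (intro integral_cong) (auto simp: sum_distrib_right mult.assoc)
      also have "\<dots> = - (\<Sum>j=1..n. integral {0..b} (\<lambda>\<xi>. R j x * (W (n - j) x \<xi> * g \<xi>)))"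
        by (subst integral_neg, subst integral_sum) (auto intro!: int integrable_on_mult_right)
      finally show ?thesis by simp
    qed
    moreover have "(\<Sum>j=1..n. R j x * u (n - j) x) = \<kappa> * ((\<Sum>j=1..n. R j x * integral {0..x} (\<lambda>\<xi>. W (n - j) x \<xi> * g \<xi>))
       - (\<Sum>j=1..n. R j x * integral {0..a} (\<lambda>\<xi>. W (n - j) x \<xi> * g \<xi>)))"
      unfolding u_def sum_subtractf[symmetric] sum_distrib_left
      by (intro sum.cong) (auto simp: algebra_simps)
    ultimately show ?thesis by (simp add: u_def algebra_simps)
  qed
qed

end

subsection \<open>The derivative \<open>V\<close> as an ordinary derivative\<close>

text \<open>The quotient is controlled only along the curve \<phi>, so \<phi> has to reach every
  point near t. It does by the intermediate value theorem, since m \<noteq> 0 pushes its two ends to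
  opposite sides of t. Injectivity is not at issue: any preimage of z serves, because the bound
  holds for all small parameters.\<close>

lemma derivative_if_reparametrized_derivative:
  fixes f \<phi> :: "real \<Rightarrow> real"
  assumes \<phi>: "(\<phi> has_real_derivative m) (at 0)" "m \<noteq> 0" "continuous_on UNIV \<phi>" "\<phi> 0 = t"
    and f: "((\<lambda>\<epsilon>. (f (\<phi> \<epsilon>) - f t) / \<epsilon>) \<longlongrightarrow> D) (at 0)"
  shows "(f has_real_derivative D / m) (at t)"
proof -
  define Q where "Q z = (f z - f t) / (z - t)" for z
  have slope: "((\<lambda>\<epsilon>. (\<phi> \<epsilon> - t) / \<epsilon>) \<longlongrightarrow> m) (at 0)"
    using \<phi>(1,4) by (simp add: has_field_derivative_iff)
  have "((\<lambda>\<epsilon>. ((f (\<phi> \<epsilon>) - f t) / \<epsilon>) / ((\<phi> \<epsilon> - t) / \<epsilon>)) \<longlongrightarrow> D / m) (at 0)"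
    by (intro tendsto_divide f slope \<phi>)
  \<comment> \<open>Where \<phi> returns to t both sides are quotients by 0 and hence equal to
    0.\<close>
  moreover have "\<forall>\<^sub>F \<epsilon> in at 0. ((f (\<phi> \<epsilon>) - f t) / \<epsilon>) / ((\<phi> \<epsilon> - t) / \<epsilon>) = Q (\<phi> \<epsilon>)"
    by (auto simp: eventually_at_filter Q_def)
  ultimately have Q: "((\<lambda>\<epsilon>. Q (\<phi> \<epsilon>)) \<longlongrightarrow> D / m) (at 0)"
    by (rule Lim_transform_eventually)
  have "(Q \<longlongrightarrow> D / m) (at t)"
  proof (rule tendstoI)
    fix e :: real assume "0 < e"
    have "\<forall>\<^sub>F \<epsilon> in at 0. dist ((\<phi> \<epsilon> - t) / \<epsilon>) m < \<bar>m\<bar> / 2 \<and> dist (Q (\<phi> \<epsilon>)) (D / m) < e"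
      by (intro eventually_conj tendstoD[OF slope] tendstoD[OF Q]) (use \<phi>(2) \<open>0 < e\<close> in auto)
    then obtain d where "0 < d" and d: "\<And>\<epsilon>. \<epsilon> \<noteq> 0 \<Longrightarrow> \<bar>\<epsilon>\<bar> \<le> d \<Longrightarrow>
        \<bar>(\<phi> \<epsilon> - t) / \<epsilon> - m\<bar> < \<bar>m\<bar> / 2 \<and> dist (Q (\<phi> \<epsilon>)) (D / m) < e"
      unfolding eventually_at_le by (auto simp: dist_real_def)
    \<comment> \<open>The slope differs from m by less than half of |m|, so the displacement at both
      ends exceeds this amount times d; \<open>sgn m\<close> merges the increasing and the
      decreasing case.\<close>
    have slope_d: "\<bar>m\<bar> / 2 * d < sgn m * (\<phi> d - t)" "sgn m * (\<phi> (- d) - t) < - (\<bar>m\<bar> / 2 * d)"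
      using d[of d] d[of "- d"] \<open>0 < d\<close> \<phi>(2)
      by (auto simp: sgn_if abs_if field_simps split: if_splits)
    have conn: "connected (\<phi> ` {-d..d})"
      using \<phi>(3) by (intro connected_continuous_image) (auto intro: continuous_on_subset)
    have "dist (Q z) (D / m) < e" if z: "z \<noteq> t" "dist z t < \<bar>m\<bar> / 2 * d" for z
    proof -
      have "z \<in> \<phi> ` {-d..d}"
      proof (cases "0 < m")
        case True
        then show ?thesis
          using slope_d z \<open>0 < d\<close> connectedD_interval[OF conn, of "\<phi> (- d)" "\<phi> d" z]
          by (auto simp: dist_real_def abs_if split: if_splits)
      next
        case False
        then show ?thesis
          using slope_d z \<open>0 < d\<close> \<phi>(2) connectedD_interval[OF conn, of "\<phi> d" "\<phi> (- d)" z]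
          by (auto simp: dist_real_def abs_if split: if_splits)
      qed
      then obtain \<epsilon> where "z = \<phi> \<epsilon>" "\<bar>\<epsilon>\<bar> \<le> d" by auto
      with z(1) \<phi>(4) d[of \<epsilon>] show ?thesis by auto
    qed
    then show "\<forall>\<^sub>F z in at t. dist (Q z) (D / m) < e"
      unfolding eventually_at using \<open>0 < d\<close> \<phi>(2) by (intro exI[of _ "\<bar>m\<bar> / 2 * d"]) auto
  qed
  then show ?thesis by (simp add: has_field_derivative_iff Q_def[abs_def])
qed

lemma Gamma_nonzero: "0 < Re z \<Longrightarrow> Gamma z \<noteq> 0"
  by (auto simp: Gamma_eq_zero_iff elim!: nonpos_Ints_cases)

lemma gen_pochhammer_0: "0 < Re a \<Longrightarrow> gen_pochhammer a 0 = 1"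
  by (simp add: gen_pochhammer_def Gamma_nonzero)

lemma gen_pochhammer_nonzero: "0 < Re a \<Longrightarrow> 0 \<le> x \<Longrightarrow> gen_pochhammer a x \<noteq> 0"
  by (simp add: gen_pochhammer_def Gamma_nonzero)

text \<open>With complex parameters, reality of \<open>H\<close> on the real line is a genuine
  condition. The final theorem extracts it from the differentiability of the Cauchy
  function.\<close>

locale V_fractional_real = V_fractional \<alpha> p q \<gamma> \<beta> \<rho> \<delta> i
  for \<alpha> p q :: real and \<gamma> \<beta> \<rho> \<delta> :: complex and i :: nat +
  assumes params: "0 < \<alpha>" "0 < p" "0 < q" "0 < Re \<gamma>" "0 < Re \<beta>" "0 < Re \<rho>" "0 < Re \<delta>" "1 \<le> i"
    and H_real: "\<forall>\<^sub>F \<epsilon> in at (0::real). H (of_real \<epsilon>) \<in> \<real>"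
begin

lemma H_0: "H 0 = 1"
  unfolding H_def
  by (simp add: sum.atLeast_Suc_atMost gen_pochhammer_0 Gamma_nonzero params power_0_left)

lemma K_nonzero: "K \<noteq> 0"
  by (simp add: K_def gen_pochhammer_nonzero Gamma_nonzero params less_imp_le add_pos_pos)

text \<open>At 0 only the coefficient of degree 1 survives, and \<open>K\<close> is its reciprocal
  by definition. The truncation index is at least 1, so this term is present.\<close>

lemma H_deriv: "(H has_field_derivative inverse K) (at 0)"
proof -
  define a where "a k = Gamma \<beta> * (gen_pochhammer \<rho> (q * real k) / gen_pochhammer \<delta> (p * real k)
                          / Gamma (\<gamma> * of_nat k + \<beta>))" for k :: nat
  have H_eq: "H z = (\<Sum>k=0..i. a k * z ^ k)" for z
    unfolding H_def a_def sum_distrib_left by (intro sum.cong) (auto simp: field_simps)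
  have "((\<lambda>z. \<Sum>k=0..i. a k * z ^ k) has_field_derivative
      (\<Sum>k=0..i. a k * (of_nat k * 0 ^ (k - 1)))) (at 0)"
    by (auto intro!: derivative_eq_intros sum.cong)
  moreover have "(\<Sum>k=0..i. a k * (of_nat k * 0 ^ (k - 1))) = (\<Sum>k=0..i. if k = 1 then a 1 else 0)"
    by (intro sum.cong) (auto simp: power_0_left)
  moreover have "\<dots> = a 1" using params by simp
  moreover have "a 1 = inverse K" by (simp add: a_def K_def field_simps)
  ultimately show ?thesis by (simp add: H_eq[abs_def])
qed

lemma H_deriv_real: "((\<lambda>\<epsilon>. H (of_real \<epsilon>)) has_vector_derivative inverse K) (at 0)"
  using has_vector_derivative_real_field[of H "inverse K" 0 UNIV] H_deriv by simp

text \<open>The imaginary part of \<open>H\<close> vanishes on the real line near 0, hence so does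
  that of its derivative there, which is the inverse of \<open>K\<close>.\<close>

lemma K_real: "K = of_real (Re K)"
proof -
  have "((\<lambda>\<epsilon>. Im (H (of_real \<epsilon>))) has_vector_derivative Im (inverse K)) (at 0)"
    using bounded_linear.has_vector_derivative[OF bounded_linear_Im H_deriv_real] .
  then have "((\<lambda>\<epsilon>. Im (H (of_real \<epsilon>))) has_real_derivative Im (inverse K)) (at 0)"
    by (simp add: has_real_derivative_iff_has_vector_derivative)
  then have "((\<lambda>\<epsilon>. Im (H (of_real \<epsilon>)) / \<epsilon>) \<longlongrightarrow> Im (inverse K)) (at 0)"
    by (simp add: has_field_derivative_iff H_0)
  moreover have "\<forall>\<^sub>F \<epsilon> in at 0. Im (H (of_real \<epsilon>)) / \<epsilon> = 0"
    using H_real by eventually_elim (simp add: complex_is_Real_iff)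
  then have "((\<lambda>\<epsilon>. Im (H (of_real \<epsilon>)) / \<epsilon>) \<longlongrightarrow> 0) (at 0)"
    by (rule tendsto_eventually)
  ultimately have "Im (inverse K) = 0"
    using tendsto_unique trivial_limit_at by blast
  then have "inverse K \<in> \<real>" by (simp add: complex_is_Real_iff)
  then have "K \<in> \<real>" using Reals_inverse by fastforce
  then show ?thesis by simp
qed

lemma Re_K_nonzero: "Re K \<noteq> 0"
  using K_nonzero K_real by fastforce

text \<open>The real curve through t along which \<open>V\<close> differentiates; its velocity at 0
  is \<open>t powr (1 - \<alpha>) / Re K\<close>.\<close>

definition orbit :: "real \<Rightarrow> real \<Rightarrow> real" where
  "orbit t \<epsilon> = Re (V_point t \<epsilon>)"

lemma orbit_eq: "orbit t \<epsilon> = t * Re (H (of_real (\<epsilon> * t powr (- \<alpha>))))"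
  unfolding orbit_def V_point_def by (simp only: Re_complex_of_real Im_complex_of_real times_complex.sel)

lemma orbit_0: "orbit t 0 = t"
  by (simp add: orbit_eq H_0)

lemma orbit_deriv:
  assumes "0 < t"
  shows "(orbit t has_real_derivative t powr (1 - \<alpha>) / Re K) (at 0)"
proof -
  have "((\<lambda>\<epsilon>. Re (H (of_real \<epsilon>))) has_vector_derivative Re (inverse K)) (at 0)"
    using bounded_linear.has_vector_derivative[OF bounded_linear_Re H_deriv_real] .
  moreover have "Re (inverse K) = 1 / Re K"
    by (subst K_real) (metis Re_complex_of_real inverse_eq_divide of_real_inverse)
  ultimately have "((\<lambda>\<epsilon>. Re (H (of_real \<epsilon>))) has_real_derivative 1 / Re K) (at (0 * t powr (- \<alpha>)))"
    by (simp add: has_real_derivative_iff_has_vector_derivative)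
  then have "((\<lambda>\<epsilon>. Re (H (of_real (\<epsilon> * t powr (- \<alpha>))))) has_real_derivative
      1 / Re K * (t powr (- \<alpha>))) (at 0)"
    by (rule DERIV_chain2) (auto intro!: derivative_eq_intros)
  then have "((\<lambda>\<epsilon>. t * Re (H (of_real (\<epsilon> * t powr (- \<alpha>))))) has_real_derivative
      t * (1 / Re K * (t powr (- \<alpha>)))) (at 0)"
    by (rule DERIV_cmult)
  moreover have "t * (1 / Re K * (t powr (- \<alpha>))) = t powr (1 - \<alpha>) / Re K"
    using assms powr_mult_base[of t "- \<alpha>"] by simp
  ultimately show ?thesis unfolding orbit_eq[abs_def] by metis
qed

lemma orbit_continuous: "continuous_on UNIV (orbit t)"
proof -
  have "Gamma (\<gamma> * complex_of_nat k + \<beta>) \<noteq> 0" for k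
    using params by (intro Gamma_nonzero) (auto intro: add_nonneg_pos)
  then show ?thesis
    unfolding orbit_eq[abs_def] H_def by (intro continuous_intros) auto
qed

lemma V_point_nonneg:
  assumes "0 < t"
  shows "\<forall>\<^sub>F \<epsilon> in at 0. V_point t \<epsilon> \<in> \<real>\<^sub>\<ge>\<^sub>0"
proof -
  have "isCont (orbit t) 0"
    using orbit_continuous by (simp add: continuous_on_eq_continuous_at)
  then have "\<forall>\<^sub>F \<epsilon> in at 0. 0 < orbit t \<epsilon>"
    using assms orbit_0[of t] by (intro order_tendstoD(1)[of _ t]) (auto simp: isCont_def)
  moreover have "filterlim (\<lambda>\<epsilon>. \<epsilon> * t powr (- \<alpha>)) (at 0) (at 0)"
    using assms by (auto simp: filterlim_at eventually_at_filter intro!: tendsto_eq_intros)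
  then have "\<forall>\<^sub>F \<epsilon> in at 0. H (of_real (\<epsilon> * t powr (- \<alpha>))) \<in> \<real>"
    using H_real by (rule eventually_compose_filterlim[rotated])
  ultimately show ?thesis
  proof eventually_elim
    case (elim \<epsilon>)
    have "V_point t \<epsilon> \<in> \<real>" unfolding V_point_def by (intro Reals_mult elim) simp
    with elim show ?case by (simp add: complex_nonneg_Reals_iff complex_is_Real_iff orbit_def)
  qed
qed

text \<open>From right to left this is the chain rule along the orbit. From left to right it is the
  reparametrization lemma, as f is not known to be differentiable beforehand.\<close>

lemma has_V_derivative_pos_iff:
  "has_V_derivative_pos f t D \<longleftrightarrow>
     0 < t \<and> (f has_real_derivative Re K * t powr (\<alpha> - 1) * D) (at t)"
proof -
  have "((\<lambda>\<epsilon>. (f (orbit t \<epsilon>) - f t) / \<epsilon>) \<longlongrightarrow> D) (at 0) \<longleftrightarrow>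
      (f has_real_derivative Re K * t powr (\<alpha> - 1) * D) (at t)" if t: "0 < t"
  proof -
    have m: "D / (t powr (1 - \<alpha>) / Re K) = Re K * t powr (\<alpha> - 1) * D"
      using t by (simp add: field_simps powr_diff)
    show ?thesis
    proof
      assume "((\<lambda>\<epsilon>. (f (orbit t \<epsilon>) - f t) / \<epsilon>) \<longlongrightarrow> D) (at 0)"
      from derivative_if_reparametrized_derivative[OF orbit_deriv[OF t] _ orbit_continuous orbit_0 this]
      show "(f has_real_derivative Re K * t powr (\<alpha> - 1) * D) (at t)"
        using t Re_K_nonzero m by simp
    next
      assume "(f has_real_derivative Re K * t powr (\<alpha> - 1) * D) (at t)"
      then have "(f has_real_derivative Re K * t powr (\<alpha> - 1) * D) (at (orbit t 0))"
        by (simp add: orbit_0)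
      from DERIV_chain2[OF this orbit_deriv[OF t]]
      have "((\<lambda>\<epsilon>. f (orbit t \<epsilon>)) has_real_derivative D) (at 0)"
        using t Re_K_nonzero by (simp add: m[symmetric])
      then show "((\<lambda>\<epsilon>. (f (orbit t \<epsilon>) - f t) / \<epsilon>) \<longlongrightarrow> D) (at 0)"
        by (simp add: has_field_derivative_iff orbit_0)
    qed
  qed
  then show ?thesis
    using V_point_nonneg[of t] by (auto simp: has_V_derivative_pos_def orbit_def)
qed

lemma has_V_derivative_pos_unique:
  assumes "has_V_derivative_pos f t D" "has_V_derivative_pos f t D'"
  shows "D = D'"
proof -
  have "Re K * t powr (\<alpha> - 1) * D = Re K * t powr (\<alpha> - 1) * D'" "0 < t"
    using assms DERIV_unique unfolding has_V_derivative_pos_iff by blast+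
  then show ?thesis using Re_K_nonzero by simp
qed

lemma has_V_derivative_unique:
  assumes "has_V_derivative f t D" "has_V_derivative f t D'"
  shows "D = D'"
proof (cases "0 < t")
  case True
  then show ?thesis
    using assms has_V_derivative_pos_unique by (auto simp: has_V_derivative_def)
next
  case False
  then have "\<not> has_V_derivative_pos f t D" for D
    by (simp add: has_V_derivative_pos_def)
  with assms obtain g h where
    g: "\<forall>\<^sub>F x in at_right 0. has_V_derivative_pos f x (g x)" "(g \<longlongrightarrow> D) (at_right 0)" and
    h: "\<forall>\<^sub>F x in at_right 0. has_V_derivative_pos f x (h x)" "(h \<longlongrightarrow> D') (at_right 0)"
    unfolding has_V_derivative_def by blast
  have "\<forall>\<^sub>F x in at_right 0. g x = h x"
    using g(1) h(1) by eventually_elim (rule has_V_derivative_pos_unique)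
  with g(2) have "(h \<longlongrightarrow> D) (at_right 0)"
    by (rule Lim_transform_eventually)
  with h(2) show ?thesis
    using tendsto_unique trivial_limit_at_right_real by blast
qed

lemma V_eqI: "has_V_derivative f t D \<Longrightarrow> V f t = D"
  unfolding V_def using has_V_derivative_unique by blast

lemma has_V_derivative_V: "V_differentiable f t \<Longrightarrow> has_V_derivative f t (V f t)"
  using V_eqI by (auto simp: V_differentiable_def)

lemma derivative_if_V_differentiable:
  assumes "V_differentiable f t" "0 < t"
  shows "(f has_real_derivative Re K * t powr (\<alpha> - 1) * V f t) (at t)"
  using has_V_derivative_V[OF assms(1)] assms(2)
  by (auto simp: has_V_derivative_def has_V_derivative_pos_iff)

text \<open>\<open>V f 0\<close> is by definition a right limit. Iterates of positive order are
  therefore right-continuous at 0, whereas the function itself need not be.\<close>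

lemma V_tendsto_at_0:
  assumes "V_differentiable f 0"
  shows "(V f \<longlongrightarrow> V f 0) (at_right 0)"
proof -
  obtain g where g: "\<forall>\<^sub>F x in at_right 0. has_V_derivative_pos f x (g x)"
      "(g \<longlongrightarrow> V f 0) (at_right 0)"
    using has_V_derivative_V[OF assms] by (auto simp: has_V_derivative_def has_V_derivative_pos_def)
  from g(1) have "\<forall>\<^sub>F x in at_right 0. g x = V f x"
    by eventually_elim (metis V_eqI has_V_derivative_def)
  with g(2) show ?thesis by (rule Lim_transform_eventually)
qed

lemma has_V_derivative_posI:
  assumes "0 < t" "(f has_real_derivative Re K * t powr (\<alpha> - 1) * D) (at t)"
  shows "has_V_derivative f t D"
  using assms by (simp add: has_V_derivative_def has_V_derivative_pos_iff)

lemma has_V_derivative_0I: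
  assumes "\<And>t. 0 < t \<Longrightarrow> (f has_real_derivative Re K * t powr (\<alpha> - 1) * g t) (at t)"
    and "(g \<longlongrightarrow> D) (at_right 0)"
  shows "has_V_derivative f 0 D"
proof -
  have "\<forall>\<^sub>F x in at_right 0. has_V_derivative_pos f x (g x)"
    using eventually_at_right_less by eventually_elim (simp add: has_V_derivative_pos_iff assms(1))
  with assms(2) show ?thesis unfolding has_V_derivative_def by blast
qed

text \<open>A criterion for recognizing the iterates from a family of candidates. Agreement of y
  with \<open>G 0\<close> is asked for only at t > 0, so \<open>y 0\<close> is arbitrary and the
  conclusion at 0 starts with j = 1.\<close>

lemma V_iterates:
  fixes G :: "nat \<Rightarrow> real \<Rightarrow> real"
  assumes deriv: "\<And>j t. j < m \<Longrightarrow> 0 < t \<Longrightarrow>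
      (G j has_real_derivative Re K * t powr (\<alpha> - 1) * G (Suc j) t) (at t)"
    and lim: "\<And>j. j < m \<Longrightarrow> (G (Suc j) \<longlongrightarrow> G (Suc j) 0) (at_right 0)"
    and base: "\<And>t. 0 < t \<Longrightarrow> y t = G 0 t"
  shows "n_times_V_differentiable m y"
    and "\<And>j t. j \<le> m \<Longrightarrow> 0 < t \<or> t = 0 \<and> 0 < j \<Longrightarrow> (V ^^ j) y t = G j t"
proof -
  have step: "has_V_derivative ((V ^^ j) y) t (G (Suc j) t)"
    if "j < m" "0 \<le> t" and eq: "\<And>t. 0 < t \<Longrightarrow> (V ^^ j) y t = G j t" for j t
  proof -
    have d: "((V ^^ j) y has_real_derivative Re K * t powr (\<alpha> - 1) * G (Suc j) t) (at t)" if "0 < t" for t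
      using deriv[OF \<open>j < m\<close> that]
      by (rule has_field_derivative_transform_within_open[where S = "{0<..}"]) (use that eq in auto)
    show ?thesis
    proof (cases "t = 0")
      case True
      then show ?thesis using has_V_derivative_0I[OF d lim[OF \<open>j < m\<close>]] by simp
    qed (use that has_V_derivative_posI d in auto)
  qed
  have eq: "(V ^^ j) y t = G j t" if "j \<le> m" "0 < t" for j t
    using that
  proof (induction j arbitrary: t)
    case (Suc j)
    then show ?case using V_eqI[OF step[of j t]] by simp
  qed (simp add: base)
  show "n_times_V_differentiable m y"
    unfolding n_times_V_differentiable_def V_differentiable_def using step eq by (meson less_imp_le)
  fix j and t :: real assume "j \<le> m" "0 < t \<or> t = 0 \<and> 0 < j"
  then show "(V ^^ j) y t = G j t"
    using eq[of j t] V_eqI[OF step[of "j - 1" t]] eq by (cases j) auto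
qed

subsection \<open>Change of variable\<close>

text \<open>The antiderivative of the weight \<open>t powr (\<alpha> - 1)\<close> that vanishes at
  0; \<open>from_x\<close> is its inverse on the half-line.\<close>

definition to_x :: "real \<Rightarrow> real" where "to_x t = t powr \<alpha> / \<alpha>"
definition from_x :: "real \<Rightarrow> real" where "from_x x = (\<alpha> * x) powr (1 / \<alpha>)"

text \<open>The equivalence includes negative t, because \<open>powr\<close> is an exponential at
  every nonzero base.\<close>

lemma to_x_simps [simp]: "to_x 0 = 0" "0 < to_x t \<longleftrightarrow> t \<noteq> 0" "0 \<le> to_x t"
  using params by (auto simp: to_x_def)

lemma from_x_simps [simp]: "from_x 0 = 0" "0 \<le> from_x x" "0 < x \<Longrightarrow> 0 < from_x x"
  using params by (auto simp: from_x_def)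

lemma from_to_x [simp]: "0 \<le> t \<Longrightarrow> from_x (to_x t) = t"
  using params by (simp add: from_x_def to_x_def powr_powr)

lemma to_from_x [simp]: "0 \<le> x \<Longrightarrow> to_x (from_x x) = x"
  using params by (simp add: from_x_def to_x_def powr_powr)

lemma to_x_deriv: "0 < t \<Longrightarrow> (to_x has_real_derivative t powr (\<alpha> - 1)) (at t)"
  unfolding to_x_def[abs_def] using params by (auto intro!: derivative_eq_intros)

lemma from_x_deriv: "0 < x \<Longrightarrow> (from_x has_real_derivative from_x x powr (1 - \<alpha>)) (at x)"
  unfolding from_x_def[abs_def] using params
  by (auto intro!: derivative_eq_intros simp: powr_powr diff_divide_distrib)

lemma to_x_continuous: "continuous_on {0..} to_x"
  unfolding to_x_def[abs_def] using params by (intro continuous_intros continuous_on_powr') auto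

lemma from_x_continuous: "continuous_on {0..} from_x"
  unfolding from_x_def[abs_def] using params by (intro continuous_intros continuous_on_powr') auto

lemma from_x_at_0: "filterlim from_x (at_right 0) (at_right 0)"
  using tendsto_at_right_0_if_continuous_on[OF from_x_continuous] eventually_at_right_less[of "0::real"]
  by (auto simp: filterlim_at elim!: eventually_mono dest: from_x_simps(3))

lemma derivative_in_x:
  assumes "(u has_real_derivative Re K * from_x x powr (\<alpha> - 1) * D) (at (from_x x))" "0 < x"
  shows "((\<lambda>x. u (from_x x)) has_real_derivative Re K * D) (at x)"
proof -
  have "from_x x powr (\<alpha> - 1) * from_x x powr (1 - \<alpha>) = 1"
    using from_x_simps(3)[OF assms(2)] by (simp flip: powr_add)
  then have "Re K * from_x x powr (\<alpha> - 1) * D * from_x x powr (1 - \<alpha>) = Re K * D"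
    by (simp add: mult_ac)
  with DERIV_chain2[OF assms(1) from_x_deriv[OF assms(2)]] show ?thesis by simp
qed

text \<open>The substitution \<xi> = \<open>to_x \<tau>\<close>, carried out with the antiderivative
  A. The weight may be singular at 0 and F is arbitrary there, so the fundamental theorem on open
  intervals is used; it needs limits of A at the ends and integrability.\<close>

lemma V_integral_eq:
  assumes w: "continuous_on {0..} w" and st: "0 \<le> s" "0 \<le> t"
    and eq: "\<And>\<tau>. 0 < \<tau> \<Longrightarrow> F \<tau> = w (to_x \<tau>)"
  shows "V_integral s t F = Re K * (integral {0..to_x t} w - integral {0..to_x s} w)"
proof -
  define A where "A \<tau> = integral {0..to_x \<tau>} w" for \<tau>
  have A_cont: "continuous_on {0..} A"
  proof -
    have "continuous_on {0..} (\<lambda>x. integral {0..x} w)"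
      using integral_has_derivative_halfline[OF w]
      by (intro DERIV_continuous_on) auto
    then show ?thesis
      unfolding A_def[abs_def] by (rule continuous_on_compose2[OF _ to_x_continuous]) auto
  qed
  have A_deriv: "(A has_real_derivative F \<tau> * \<tau> powr (\<alpha> - 1)) (at \<tau>)" if "0 < \<tau>" for \<tau>
  proof -
    have "to_x \<tau> \<in> interior {0..}" using that by (simp add: interior_real_atLeast)
    then have "((\<lambda>x. integral {0..x} w) has_real_derivative w (to_x \<tau>)) (at (to_x \<tau>))"
      using integral_has_derivative_halfline[OF w, of "to_x \<tau>"] at_within_interior by (metis to_x_simps(3))
    from DERIV_chain2[OF this to_x_deriv[OF that]] show ?thesis
      by (simp add: A_def[abs_def] eq that)
  qed
  have main: "(LBINT \<tau>=ereal a..ereal b. F \<tau> * \<tau> powr (\<alpha> - 1)) = A b - A a" if ab: "0 \<le> a" "a < b" for a b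
  proof (rule interval_integral_FTC_integrable[where F = A])
    show "ereal a < ereal b" using ab by simp
    have F_cont: "continuous_on {0<..} F"
    proof -
      have "continuous_on {0<..} (\<lambda>\<tau>. w (to_x \<tau>))"
        by (intro continuous_on_compose2[OF w] continuous_on_subset[OF to_x_continuous]) auto
      then show ?thesis by (rule continuous_on_eq) (simp add: eq)
    qed
    have powr_cont: "continuous_on {0<..} (\<lambda>\<tau>::real. \<tau> powr (\<alpha> - 1))"
      by (intro continuous_intros) auto
    have lim_at_right: "((B \<circ> real_of_ereal) \<longlongrightarrow> B a) (at_right (ereal a))"
      and lim_at_left: "((B \<circ> real_of_ereal) \<longlongrightarrow> B b) (at_left (ereal b))"
      if "continuous_on {0..} B" for B :: "real \<Rightarrow> real"
    proof -
      have "(B \<longlongrightarrow> B a) (at a within {0..})" "(B \<longlongrightarrow> B b) (at b within {0..})"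
        using that ab by (auto simp: continuous_on_def)
      then have "(B \<longlongrightarrow> B a) (at_right a)" "(B \<longlongrightarrow> B b) (at b within {0<..<b})"
        using ab by (auto elim!: tendsto_within_subset)
      moreover have "at b within {0<..<b} = at_left b"
        by (rule at_within_nhd[of _ "{0<..}"]) (use ab in auto)
      ultimately show "((B \<circ> real_of_ereal) \<longlongrightarrow> B a) (at_right (ereal a))"
        "((B \<circ> real_of_ereal) \<longlongrightarrow> B b) (at_left (ereal b))"
        by (simp_all add: ereal_tendsto_simps1)
    qed
    show "((A \<circ> real_of_ereal) \<longlongrightarrow> A a) (at_right (ereal a))"
      "((A \<circ> real_of_ereal) \<longlongrightarrow> A b) (at_left (ereal b))"
      using lim_at_right lim_at_left A_cont by blast+
    show "(A has_vector_derivative F \<tau> * \<tau> powr (\<alpha> - 1)) (at \<tau>)" if "ereal a < ereal \<tau>" for \<tau>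
      using A_deriv[of \<tau>] that ab by (simp add: has_real_derivative_iff_has_vector_derivative)
    have isCont: "isCont F \<tau>" "isCont (\<lambda>\<tau>. \<tau> powr (\<alpha> - 1)) \<tau>" if "ereal a < ereal \<tau>" for \<tau>
      using F_cont powr_cont that ab by (auto simp: continuous_on_eq_continuous_at)
    then show "isCont (\<lambda>\<tau>. F \<tau> * \<tau> powr (\<alpha> - 1)) \<tau>" if "ereal a < ereal \<tau>" for \<tau>
      using that by (intro isCont_mult) auto
    \<comment> \<open>The weight is nonnegative with an antiderivative that has finite limits at
      both ends, so it is integrable even when a = 0. Since F is bounded on the interval, the
      product is dominated by a multiple of it.\<close>
    have "set_integrable lborel (einterval a b) (\<lambda>\<tau>. \<tau> powr (\<alpha> - 1))"
    proof (rule interval_integral_FTC_nonneg(1))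
      show "((to_x \<circ> real_of_ereal) \<longlongrightarrow> to_x a) (at_right (ereal a))"
        "((to_x \<circ> real_of_ereal) \<longlongrightarrow> to_x b) (at_left (ereal b))"
        using lim_at_right lim_at_left to_x_continuous by blast+
    qed (use ab to_x_deriv isCont in auto)
    then have int: "set_integrable lborel {a<..<b} (\<lambda>\<tau>. \<tau> powr (\<alpha> - 1))" by simp
    have "bounded (w ` {0..to_x b})"
      using w by (intro compact_imp_bounded compact_continuous_image) (auto intro: continuous_on_subset)
    then obtain C where C: "\<And>x. x \<in> {0..to_x b} \<Longrightarrow> \<bar>w x\<bar> \<le> C"
      unfolding bounded_iff by (metis imageI real_norm_def)
    have F_le: "\<bar>F \<tau>\<bar> \<le> C" if "\<tau> \<in> {a<..<b}" for \<tau>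
    proof -
      have "to_x \<tau> \<le> to_x b"
        using that ab params unfolding to_x_def by (intro divide_right_mono powr_mono2) auto
      with that ab C[of "to_x \<tau>"] show ?thesis by (simp add: eq)
    qed
    have "set_integrable lborel {a<..<b} (\<lambda>\<tau>. C * \<tau> powr (\<alpha> - 1))"
      using int by (rule set_integrable_mult_right)
    then have "set_integrable lborel {a<..<b} (\<lambda>\<tau>. F \<tau> * \<tau> powr (\<alpha> - 1))"
    proof (rule set_integrable_bound)
      have cont: "continuous_on {a<..<b} (\<lambda>\<tau>. F \<tau> * \<tau> powr (\<alpha> - 1))"
        by (rule continuous_on_subset[OF continuous_on_mult[OF F_cont powr_cont]]) (use ab in auto)
      show "set_borel_measurable lborel {a<..<b} (\<lambda>\<tau>. F \<tau> * \<tau> powr (\<alpha> - 1))"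
        using borel_measurable_continuous_on_indicator[OF _ cont]
        unfolding set_borel_measurable_def by simp
      show "AE \<tau> in lborel. \<tau> \<in> {a<..<b} \<longrightarrow> norm (F \<tau> * \<tau> powr (\<alpha> - 1)) \<le> norm (C * \<tau> powr (\<alpha> - 1))"
        using F_le by (auto simp: abs_mult intro!: mult_right_mono order_trans[OF F_le abs_ge_self])
    qed
    then show "set_integrable lborel (einterval a b) (\<lambda>\<tau>. F \<tau> * \<tau> powr (\<alpha> - 1))" by simp
  qed
  have "(LBINT \<tau>=ereal s..ereal t. F \<tau> * \<tau> powr (\<alpha> - 1)) = A t - A s"
  proof (cases s t rule: linorder_cases)
    case greater
    then show ?thesis
      using main[of t s] st by (simp add: interval_integral_endpoints_reverse[of s t])
  qed (use main st in auto)
  then show ?thesis by (simp add: V_integral_def A_def)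
qed

end

subsection \<open>The fractional equation\<close>

locale V_fractional_equation = V_fractional_real \<alpha> p q \<gamma> \<beta> \<rho> \<delta> i
  for \<alpha> p q :: real and \<gamma> \<beta> \<rho> \<delta> :: complex and i :: nat +
  fixes n :: nat and r :: "nat \<Rightarrow> real \<Rightarrow> real"
  assumes n1: "1 \<le> n" and r_cont: "\<And>j. j \<in> {1..n} \<Longrightarrow> continuous_on {0..} (r j)"
begin

sublocale linear_chain n "Re K" "\<lambda>j x. r j (from_x x)"
proof
  fix j assume "j \<in> {1..n}"
  then show "continuous_on {0..} (\<lambda>x. r j (from_x x))"
    by (intro continuous_on_compose2[OF r_cont from_x_continuous]) auto
qed (rule n1)

lemma V_differentiable_iterate:
  "n_times_V_differentiable n u \<Longrightarrow> j < n \<Longrightarrow> 0 \<le> t \<Longrightarrow> V_differentiable ((V ^^ j) u) t"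
  by (simp add: n_times_V_differentiable_def)

lemma solution_chain:
  assumes "solution n r f u"
  shows "chain (\<lambda>x. f (from_x x)) (\<lambda>j x. (V ^^ j) u (from_x x))"
  unfolding chain_def
proof (intro allI impI conjI)
  fix x :: real assume x: "0 < x"
  have u: "n_times_V_differentiable n u" "\<And>t. 0 \<le> t \<Longrightarrow> L n r u t = f t"
    using assms by (auto simp: solution_def)
  show "((\<lambda>x. (V ^^ j) u (from_x x)) has_real_derivative Re K * (V ^^ Suc j) u (from_x x)) (at x)"
    if "j < n" for j
  proof (rule derivative_in_x[OF _ x])
    show "((V ^^ j) u has_real_derivative Re K * from_x x powr (\<alpha> - 1) * (V ^^ Suc j) u (from_x x))
        (at (from_x x))"
      using derivative_if_V_differentiable[OF V_differentiable_iterate[OF u(1) that], of "from_x x"] x by simp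
  qed
  show "(V ^^ n) u (from_x x) = f (from_x x) - (\<Sum>j = 1..n. r j (from_x x) * (V ^^ (n - j)) u (from_x x))"
    using u(2)[of "from_x x"] by (simp add: L_def)
qed

text \<open>Order 0 is excluded, since differentiability at 0 says nothing about the value
  \<open>u 0\<close>.\<close>

lemma iterate_tendsto_at_0:
  assumes "n_times_V_differentiable n u" "0 < j" "j \<le> n"
  shows "((\<lambda>x. (V ^^ j) u (from_x x)) \<longlongrightarrow> (V ^^ j) u 0) (at_right 0)"
  using V_tendsto_at_0[OF V_differentiable_iterate[OF assms(1), of "j - 1" 0]] assms(2,3)
    filterlim_compose[OF _ from_x_at_0] by (cases j) auto

end

section \<open>The continuous propagator attached to a Cauchy function\<close>

locale V_fractional_cauchy = V_fractional_equation +
  fixes Y :: "real \<Rightarrow> real \<Rightarrow> real"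
  assumes cauchy: "cauchy_function n r Y"
begin

lemma cauchyD:
  assumes "0 \<le> \<tau>"
  shows "solution n r (\<lambda>_. 0) (\<lambda>t. Y t \<tau>)"
    and "j < n \<Longrightarrow> (V ^^ j) (\<lambda>t. Y t \<tau>) \<tau> = (if j = n - 1 then 1 else 0)"
  using cauchy assms unfolding cauchy_function_def by (auto simp: le_less less_diff_conv)

text \<open>The conclusions of \<open>propagator_extension\<close> bundled into one predicate, so
  that a single function with all of them can be chosen. It is tied to Y only at positive
  points.\<close>

definition is_propagator :: "(nat \<Rightarrow> real \<Rightarrow> real \<Rightarrow> real) \<Rightarrow> bool" where
  "is_propagator W \<longleftrightarrow>
    (\<forall>j\<le>n. continuous_on ({0..} \<times> {0..}) (\<lambda>(x, \<xi>). W j x \<xi>)) \<and>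
    (\<forall>j<n. \<forall>x>0. \<forall>\<xi>>0. W j x \<xi> = (V ^^ j) (\<lambda>t. Y t (from_x \<xi>)) (from_x x)) \<and>
    (\<forall>j<n. \<forall>\<xi>\<ge>0. W j \<xi> \<xi> = (if j = n - 1 then 1 else 0)) \<and>
    (\<forall>x\<ge>0. \<forall>\<xi>\<ge>0. W n x \<xi> = - (\<Sum>j=1..n. r j (from_x x) * W (n - j) x \<xi>)) \<and>
    (\<forall>j<n. \<forall>x\<ge>0. \<forall>\<xi>\<ge>0.
      ((\<lambda>x. W j x \<xi>) has_real_derivative Re K * W (Suc j) x \<xi>) (at x within {0..}))"

lemma propagator_exists: "\<exists>W. is_propagator W"
proof (rule propagator_extension[of "\<lambda>j x \<xi>. (V ^^ j) (\<lambda>t. Y t (from_x \<xi>)) (from_x x)"])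
  show "chain (\<lambda>_. 0) (\<lambda>j x. (V ^^ j) (\<lambda>t. Y t (from_x \<xi>)) (from_x x))" for \<xi>
    using solution_chain[OF cauchyD(1)[of "from_x \<xi>"]] by simp
  show "(V ^^ j) (\<lambda>t. Y t (from_x \<xi>)) (from_x \<xi>) = (if j = n - 1 then 1 else 0)" if "j < n" for j \<xi>
    using cauchyD(2)[OF _ that] by simp
qed (rule_tac x = W in exI, simp add: is_propagator_def)

definition propagator :: "nat \<Rightarrow> real \<Rightarrow> real \<Rightarrow> real" where
  "propagator = (SOME W. is_propagator W)"

lemma propagator_is_propagator: "is_propagator propagator"
  unfolding propagator_def using propagator_exists by (rule someI_ex)

lemma propagator:
  shows propagator_continuous: "\<And>j. j \<le> n \<Longrightarrow> continuous_on ({0..} \<times> {0..}) (\<lambda>(x, \<xi>). propagator j x \<xi>)"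
    and propagator_eq: "\<And>j x \<xi>. j < n \<Longrightarrow> 0 < x \<Longrightarrow> 0 < \<xi> \<Longrightarrow>
      propagator j x \<xi> = (V ^^ j) (\<lambda>t. Y t (from_x \<xi>)) (from_x x)"
    and propagator_diag: "\<And>j \<xi>. j < n \<Longrightarrow> 0 \<le> \<xi> \<Longrightarrow> propagator j \<xi> \<xi> = (if j = n - 1 then 1 else 0)"
    and propagator_top: "\<And>x \<xi>. 0 \<le> x \<Longrightarrow> 0 \<le> \<xi> \<Longrightarrow>
      propagator n x \<xi> = - (\<Sum>j=1..n. r j (from_x x) * propagator (n - j) x \<xi>)"
    and propagator_deriv: "\<And>j x \<xi>. j < n \<Longrightarrow> 0 \<le> x \<Longrightarrow> 0 \<le> \<xi> \<Longrightarrow>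
      ((\<lambda>x. propagator j x \<xi>) has_real_derivative Re K * propagator (Suc j) x \<xi>) (at x within {0..})"
  using propagator_is_propagator unfolding is_propagator_def by simp_all

lemma propagator_top_eq:
  assumes "0 < x" "0 < \<xi>"
  shows "propagator n x \<xi> = (V ^^ n) (\<lambda>t. Y t (from_x \<xi>)) (from_x x)"
proof -
  have "propagator n x \<xi> = - (\<Sum>j=1..n. r j (from_x x) * propagator (n - j) x \<xi>)"
    using assms by (intro propagator_top) auto
  also have "\<dots> = - (\<Sum>j=1..n. r j (from_x x) * (V ^^ (n - j)) (\<lambda>t. Y t (from_x \<xi>)) (from_x x))"
    using assms by (simp add: propagator_eq)
  finally show ?thesis
    using chainD(2)[OF solution_chain[OF cauchyD(1)[of "from_x \<xi>"]] assms(1)] by simp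
qed

text \<open>For positive order both sides are right limits at 0 of the same function, one by
  continuity of the propagator and the other by the definition of \<open>V\<close> at 0.\<close>

lemma propagator_at_0:
  assumes "0 < j" "j \<le> n" "0 < \<xi>"
  shows "propagator j 0 \<xi> = (V ^^ j) (\<lambda>t. Y t (from_x \<xi>)) 0"
proof -
  have "((\<lambda>x. propagator j x \<xi>) \<longlongrightarrow> propagator j 0 \<xi>) (at_right 0)"
    using assms continuous_on_quadrant_sections(1)[OF propagator_continuous]
    by (intro tendsto_at_right_0_if_continuous_on) auto
  moreover have "\<forall>\<^sub>F x in at_right 0. propagator j x \<xi> = (V ^^ j) (\<lambda>t. Y t (from_x \<xi>)) (from_x x)"
    using eventually_at_right_less[of "0::real"]
    by eventually_elim (use assms propagator_eq propagator_top_eq in \<open>cases "j = n", auto\<close>)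
  ultimately have "((\<lambda>x. (V ^^ j) (\<lambda>t. Y t (from_x \<xi>)) (from_x x)) \<longlongrightarrow> propagator j 0 \<xi>) (at_right 0)"
    by (rule Lim_transform_eventually)
  moreover have "((\<lambda>x. (V ^^ j) (\<lambda>t. Y t (from_x \<xi>)) (from_x x)) \<longlongrightarrow> (V ^^ j) (\<lambda>t. Y t (from_x \<xi>)) 0)
      (at_right 0)"
    using cauchyD(1)[of "from_x \<xi>"] assms by (intro iterate_tendsto_at_0) (auto simp: solution_def)
  ultimately show ?thesis
    using tendsto_unique trivial_limit_at_right_real by blast
qed

text \<open>The value \<open>Y 0 \<tau>\<close> is not controlled by the derivatives of \<open>Y\<close>, but it is the correct one
  as soon as the equation at \<open>0\<close> sees it.\<close>

lemma cauchy_at_0: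
  assumes "r n 0 \<noteq> 0" "0 < \<tau>"
  shows "Y 0 \<tau> = propagator 0 0 (to_x \<tau>)"
proof -
  define \<xi> where "\<xi> = to_x \<tau>"
  have \<xi>: "0 < \<xi>" "from_x \<xi> = \<tau>" using assms by (auto simp: \<xi>_def)
  \<comment> \<open>The term j = n is the only one containing the undifferentiated value
    \<open>Y 0 \<tau>\<close>. All others agree with the propagator, so comparing the two equations
    at 0 isolates this value.\<close>
  have sum_split: "(\<Sum>j=1..n. g j) = (\<Sum>j=1..<n. g j) + g n" for g :: "nat \<Rightarrow> real"
    using n1 by (simp add: sum.last_plus add.commute)
  have "L n r (\<lambda>t. Y t \<tau>) 0 = 0"
    using cauchyD(1)[of \<tau>] assms by (simp add: solution_def)
  then have "propagator n 0 \<xi> + (\<Sum>j=1..<n. r j 0 * (V ^^ (n - j)) (\<lambda>t. Y t \<tau>) 0) + r n 0 * Y 0 \<tau> = 0"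
    using propagator_at_0[of n \<xi>] \<xi> n1 by (simp add: L_def sum_split del: One_nat_def)
  also have "(\<Sum>j=1..<n. r j 0 * (V ^^ (n - j)) (\<lambda>t. Y t \<tau>) 0) = (\<Sum>j=1..<n. r j 0 * propagator (n - j) 0 \<xi>)"
    using propagator_at_0[of _ \<xi>] \<xi> by (intro sum.cong) auto
  also have "propagator n 0 \<xi> = - ((\<Sum>j=1..<n. r j 0 * propagator (n - j) 0 \<xi>) + r n 0 * propagator 0 0 \<xi>)"
    using propagator_top[of 0 \<xi>] \<xi> by (simp add: sum_split del: One_nat_def)
  finally show ?thesis using assms by (simp add: \<xi>_def)
qed

text \<open>A second way to pin down the value at 0, independent of \<open>r n 0\<close>; it serves
  the continuity of y.\<close>

lemma cauchy_at_0_if_continuous: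
  assumes "continuous_on {0..} (\<lambda>t. Y t \<tau>)" "0 < \<tau>"
  shows "Y 0 \<tau> = propagator 0 0 (to_x \<tau>)"
proof -
  have "Y (from_x 0) \<tau> = propagator 0 0 (to_x \<tau>)"
  proof (rule halfline_eqI[where f = "\<lambda>x. Y (from_x x) \<tau>" and x = 0])
    show "continuous_on {0..} (\<lambda>x. Y (from_x x) \<tau>)"
      by (intro continuous_on_compose2[OF assms(1) from_x_continuous]) auto
    show "continuous_on {0..} (\<lambda>x. propagator 0 x (to_x \<tau>))"
      by (intro continuous_on_quadrant_sections(1)[OF propagator_continuous]) auto
    show "Y (from_x x) \<tau> = propagator 0 x (to_x \<tau>)" if "0 < x" for x
      using propagator_eq[of 0 x "to_x \<tau>"] that assms n1 by simp
  qed simp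
  then show ?thesis by simp
qed

section \<open>The integral formula: solution of the initial value problem, uniqueness and
  continuity\<close>

context
  fixes f y :: "real \<Rightarrow> real" and s :: real
  assumes f: "continuous_on {0..} f" and s: "0 \<le> s"
    and y: "\<And>t. 0 \<le> t \<Longrightarrow> y t = V_integral s t (\<lambda>\<tau>. Y t \<tau> * f \<tau>)"
begin

text \<open>The candidate for the j-th iterate of y in the variable x. It is built from the
  propagator instead of Y, so it is well behaved up to x = 0.\<close>

definition duhamel :: "nat \<Rightarrow> real \<Rightarrow> real" where
  "duhamel j x = Re K * (integral {0..x} (\<lambda>\<xi>. propagator j x \<xi> * f (from_x \<xi>))
      - integral {0..to_x s} (\<lambda>\<xi>. propagator j x \<xi> * f (from_x \<xi>))) + (if j = n then f (from_x x) else 0)"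

lemma f_from_x_continuous: "continuous_on {0..} (\<lambda>x. f (from_x x))"
  by (intro continuous_on_compose2[OF f from_x_continuous]) auto

lemma duhamel_deriv:
  assumes "j < n" "0 \<le> x"
  shows "(duhamel j has_real_derivative Re K * duhamel (Suc j) x) (at x within {0..})"
  unfolding duhamel_def[abs_def]
  by (rule duhamel_chain(1)[where W = propagator and g = "\<lambda>x. f (from_x x)" and a = "to_x s"];
      (rule propagator_continuous propagator_diag propagator_top propagator_deriv f_from_x_continuous)?;
      (assumption | fact assms))

lemma duhamel_top:
  assumes "0 \<le> x"
  shows "duhamel n x = f (from_x x) - (\<Sum>j=1..n. r j (from_x x) * duhamel (n - j) x)"
  unfolding duhamel_def
  by (rule duhamel_chain(2)[where W = propagator and g = "\<lambda>x. f (from_x x)" and a = "to_x s"];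
      (rule propagator_continuous propagator_diag propagator_top propagator_deriv f_from_x_continuous)?;
      (assumption | fact assms))

lemma duhamel_continuous:
  assumes "j \<le> n"
  shows "continuous_on {0..} (duhamel j)"
proof (cases "j < n")
  case True
  show ?thesis
    by (rule DERIV_continuous_on, rule duhamel_deriv[OF True]) simp
next
  \<comment> \<open>Here j = n, where no derivative is available; continuity is read off the
    equation.\<close>
  case False
  have *: "continuous_on {0..} (duhamel (n - j))" if "j \<in> {1..n}" for j
  proof (rule DERIV_continuous_on)
    show "(duhamel (n - j) has_real_derivative Re K * duhamel (Suc (n - j)) x) (at x within {0..})"
      if "x \<in> {0..}" for x
      using that \<open>j \<in> {1..n}\<close> by (intro duhamel_deriv) auto
  qed
  have "continuous_on {0..} (\<lambda>x. f (from_x x) - (\<Sum>j=1..n. r j (from_x x) * duhamel (n - j) x))"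
    by (intro continuous_intros f_from_x_continuous R_cont *)
  then have "continuous_on {0..} (duhamel n)"
    by (rule continuous_on_eq) (simp add: duhamel_top)
  with False assms show ?thesis by simp
qed

lemma duhamel_s: "j < n \<Longrightarrow> duhamel j (to_x s) = 0"
  by (simp add: duhamel_def)

lemma duhamel_chain_x: "chain (\<lambda>x. f (from_x x)) duhamel"
  unfolding chain_def
proof (intro allI impI conjI)
  fix x :: real assume x: "0 < x"
  then have "at x within {0..} = at x"
    by (intro at_within_interior) (simp add: interior_real_atLeast)
  then show "(duhamel j has_real_derivative Re K * duhamel (Suc j) x) (at x)" if "j < n" for j
    using duhamel_deriv[OF that, of x] x by simp
qed (simp add: duhamel_top)

text \<open>The integral does not see \<tau> = 0, so agreement of the kernels for \<tau> > 0 is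
  enough. For t > 0 this is automatic; for t = 0 it is the question whether
  \<open>Y 0 \<tau>\<close> is the continuous value.\<close>

lemma y_eq:
  assumes "0 \<le> t" "\<And>\<tau>. 0 < \<tau> \<Longrightarrow> Y t \<tau> = propagator 0 (to_x t) (to_x \<tau>)"
  shows "y t = duhamel 0 (to_x t)"
proof -
  let ?w = "\<lambda>\<xi>. propagator 0 (to_x t) \<xi> * f (from_x \<xi>)"
  have "continuous_on {0..} ?w"
    by (intro continuous_on_mult f_from_x_continuous
        continuous_on_quadrant_sections(2)[OF propagator_continuous]) simp_all
  then have "V_integral s t (\<lambda>\<tau>. Y t \<tau> * f \<tau>) =
      Re K * (integral {0..to_x t} ?w - integral {0..to_x s} ?w)"
    using assms by (intro V_integral_eq s) auto
  also have "\<dots> = duhamel 0 (to_x t)"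
    using n1 by (simp add: duhamel_def)
  finally have "V_integral s t (\<lambda>\<tau>. Y t \<tau> * f \<tau>) = duhamel 0 (to_x t)" .
  with y[OF assms(1)] show ?thesis by simp
qed

lemma y_eq_pos: "0 < t \<Longrightarrow> y t = duhamel 0 (to_x t)"
  using n1 by (intro y_eq) (auto simp: propagator_eq)

lemma y_n_times_V_differentiable: "n_times_V_differentiable n y"
  and y_iterates: "j \<le> n \<Longrightarrow> 0 < t \<or> t = 0 \<and> 0 < j \<Longrightarrow> (V ^^ j) y t = duhamel j (to_x t)"
proof -
  have deriv: "((\<lambda>t. duhamel j (to_x t)) has_real_derivative
      Re K * t powr (\<alpha> - 1) * duhamel (Suc j) (to_x t)) (at t)" if "j < n" "0 < t" for j t
  proof -
    have "(duhamel j has_real_derivative Re K * duhamel (Suc j) (to_x t)) (at (to_x t))"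
      using that by (intro chainD(1)[OF duhamel_chain_x]) auto
    from DERIV_chain2[OF this to_x_deriv[OF that(2)]] show ?thesis by (simp add: mult_ac)
  qed
  have lim: "((\<lambda>t. duhamel (Suc j) (to_x t)) \<longlongrightarrow> duhamel (Suc j) (to_x 0)) (at_right 0)" if "j < n" for j
  proof -
    have "continuous_on {0..} (\<lambda>t. duhamel (Suc j) (to_x t))"
      using that by (intro continuous_on_compose2[OF duhamel_continuous to_x_continuous]) auto
    then show ?thesis by (rule tendsto_at_right_0_if_continuous_on)
  qed
  note * = V_iterates[of n "\<lambda>j t. duhamel j (to_x t)" y, OF deriv lim y_eq_pos]
  show "n_times_V_differentiable n y" using *(1) .
  show "j \<le> n \<Longrightarrow> 0 < t \<or> t = 0 \<and> 0 < j \<Longrightarrow> (V ^^ j) y t = duhamel j (to_x t)" using *(2) .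
qed

lemma y_zero_ivp_solution: "zero_ivp_solution n r f s y"
proof -
  have "L n r y t = f t" if t: "0 \<le> t" for t
  proof -
    have "(\<Sum>j=1..n. r j t * (V ^^ (n - j)) y t) = (\<Sum>j=1..n. r j t * duhamel (n - j) (to_x t))"
    proof (intro sum.cong refl)
      fix j assume j: "j \<in> {1..n}"
      show "r j t * (V ^^ (n - j)) y t = r j t * duhamel (n - j) (to_x t)"
      \<comment> \<open>The only delicate term is the one with \<open>y 0\<close>. If its
        coefficient is nonzero, \<open>cauchy_at_0\<close> supplies the right value; otherwise the
        term vanishes.\<close>
      proof (cases "t = 0 \<and> j = n \<and> r n 0 \<noteq> 0")
        case True
        then show ?thesis using y_eq[of 0] cauchy_at_0 by simp
      next
        case False
        then consider "0 < t \<or> t = 0 \<and> 0 < n - j" | "r j t = 0"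
          using j t by (cases "t = 0"; cases "j = n") auto
        then show ?thesis
          using y_iterates[of "n - j" t] by cases auto
      qed
    qed
    moreover have "(V ^^ n) y t = duhamel n (to_x t)"
      using y_iterates[of n t] t n1 by (cases "t = 0") auto
    ultimately show ?thesis
      using duhamel_top[of "to_x t"] t by (simp add: L_def)
  qed
  moreover have "(V ^^ j) y s = 0" if "j < n" for j
  \<comment> \<open>\<open>y_iterates\<close> gives no information on \<open>y 0\<close>, but the
    integral from s to s is 0.\<close>
  proof (cases "s = 0 \<and> j = 0")
    case True
    then show ?thesis using y[of s] s by (simp add: V_integral_def)
  next
    case False
    then show ?thesis using y_iterates[of j s] duhamel_s[OF that] that s by (cases "s = 0") auto
  qed
  ultimately show ?thesis
    using y_n_times_V_differentiable by (simp add: zero_ivp_solution_def solution_def)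
qed

text \<open>The difference to the Duhamel solution is a homogeneous chain. For s > 0 it vanishes at
  a positive point. For s = 0 it has to tend to 0 from the right; positive orders do so by
  definition of \<open>V\<close> at 0, while order 0 relies on continuity of u.\<close>

lemma zero_ivp_unique:
  assumes u: "zero_ivp_solution n r f s u" and "0 < s \<or> continuous_on {0..} u" and t: "0 < t"
  shows "u t = y t"
proof -
  have u': "n_times_V_differentiable n u" "solution n r f u" "\<And>j. j < n \<Longrightarrow> (V ^^ j) u s = 0"
    using u by (auto simp: zero_ivp_solution_def solution_def)
  let ?w = "\<lambda>j x. (V ^^ j) u (from_x x) - duhamel j x"
  have w: "chain (\<lambda>_. 0) ?w"
    using chain_diff[OF solution_chain[OF u'(2)] duhamel_chain_x] by simp
  have "?w 0 (to_x t) = 0"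
  proof (cases "0 < s")
    case True
    show ?thesis
      by (rule chain_zero_if_zero[OF w, of "to_x s"]) (use True t n1 u'(3) duhamel_s in auto)
  next
    case False
    then have s0: "s = 0" using s by simp
    show ?thesis
    proof (rule chain_zero_if_tendsto[OF w])
      fix j assume j: "j < n"
      have "((\<lambda>x. (V ^^ j) u (from_x x)) \<longlongrightarrow> (V ^^ j) u 0) (at_right 0)"
      proof (cases "j = 0")
        case True
        have "continuous_on {0..} u" using assms(2) False by simp
        with True show ?thesis
          using filterlim_compose[OF tendsto_at_right_0_if_continuous_on from_x_at_0] by simp
      qed (use iterate_tendsto_at_0 u' j in auto)
      moreover have "(duhamel j \<longlongrightarrow> duhamel j 0) (at_right 0)"
        using duhamel_continuous j by (intro tendsto_at_right_0_if_continuous_on) auto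
      ultimately show "(?w j \<longlongrightarrow> 0) (at_right 0)"
        using u'(3)[OF j] duhamel_s[OF j] s0 tendsto_diff by fastforce
    qed (use t n1 in auto)
  qed
  then show ?thesis using y_eq_pos[OF t] t by simp
qed

lemma y_continuous:
  assumes "\<And>\<tau>. 0 \<le> \<tau> \<Longrightarrow> continuous_on {0..} (\<lambda>t. Y t \<tau>)"
  shows "continuous_on {0..} y"
proof -
  have "y t = duhamel 0 (to_x t)" if "0 \<le> t" for t
    using that y_eq_pos[of t] y_eq[of 0] cauchy_at_0_if_continuous assms by (cases "t = 0") auto
  moreover have "continuous_on {0..} (\<lambda>t. duhamel 0 (to_x t))"
    by (intro continuous_on_compose2[OF duhamel_continuous to_x_continuous]) auto
  ultimately show ?thesis by (metis (no_types, lifting) atLeast_iff continuous_on_cong)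
qed

end

end

text \<open>Uniqueness is stated in the form that \<open>V\<close> at 0 permits. For s = 0 the
  condition \<open>u 0 = 0\<close> restricts u nearby only if u is continuous, and the value of a
  solution at t = 0 is compared only among continuous functions, y being one of them when the
  sections of Y are continuous.\<close>

theorem theorem7:
  fixes \<alpha> p q s :: real
    and \<gamma> \<beta> \<rho> \<delta> :: complex
    and i n :: nat
    and r :: "nat \<Rightarrow> real \<Rightarrow> real"
    and f :: "real \<Rightarrow> real"
    and Y :: "real \<Rightarrow> real \<Rightarrow> real"
    and y :: "real \<Rightarrow> real"
  assumes "0 < \<alpha>" "\<alpha> \<le> 1" "0 < p" "0 < q"
    and "0 < Re \<gamma>" "0 < Re \<beta>" "0 < Re \<rho>" "0 < Re \<delta>" "q \<le> Re \<gamma> + p"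
    and "1 \<le> i" "1 \<le> n"
    and "\<And>j. j \<in> {1..n} \<Longrightarrow> continuous_on {0..} (r j)"
    and "0 \<le> s"
    and "continuous_on {0..} f"
    and "V_fractional.cauchy_function \<alpha> p q \<gamma> \<beta> \<rho> \<delta> i n r Y"
    and "\<And>t. 0 \<le> t \<Longrightarrow>
           y t = V_fractional.V_integral \<alpha> p q \<gamma> \<beta> \<rho> \<delta> s t (\<lambda>\<tau>. Y t \<tau> * f \<tau>)"
  shows "V_fractional.zero_ivp_solution \<alpha> p q \<gamma> \<beta> \<rho> \<delta> i n r f s y \<and>
         (\<forall>u. V_fractional.zero_ivp_solution \<alpha> p q \<gamma> \<beta> \<rho> \<delta> i n r f s u \<longrightarrow>
              0 < s \<or> continuous_on {0..} u \<longrightarrow>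
              (\<forall>t>0. u t = y t)) \<and>
         ((\<forall>\<tau>\<ge>0. continuous_on {0..} (\<lambda>t. Y t \<tau>)) \<longrightarrow>
            continuous_on {0..} y \<and>
            (\<forall>u. V_fractional.zero_ivp_solution \<alpha> p q \<gamma> \<beta> \<rho> \<delta> i n r f s u \<longrightarrow>
                 continuous_on {0..} u \<longrightarrow>
                 (\<forall>t\<ge>0. u t = y t)))"
proof -
  interpret V0: V_fractional \<alpha> p q \<gamma> \<beta> \<rho> \<delta> i .
  \<comment> \<open>The mere existence of Y forces \<open>H\<close> to be real near 0: the section
    of Y at 1 is differentiable at t = 1, where the evaluation point
    \<open>V_point 1 \<epsilon>\<close> is \<open>H \<epsilon>\<close> itself.\<close>
  have "V0.n_times_V_differentiable n (\<lambda>t. Y t 1)"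
    using assms(15) zero_le_one unfolding V0.cauchy_function_def V0.solution_def by blast
  then have "V0.V_differentiable ((V0.V ^^ 0) (\<lambda>t. Y t 1)) 1"
    using assms(11) zero_less_one zero_le_one order_less_le_trans
    unfolding V0.n_times_V_differentiable_def by blast
  then have "\<forall>\<^sub>F \<epsilon> in at (0::real). V0.V_point 1 \<epsilon> \<in> \<real>\<^sub>\<ge>\<^sub>0"
    by (auto simp: V0.V_differentiable_def V0.has_V_derivative_def V0.has_V_derivative_pos_def)
  then have H_real: "\<forall>\<^sub>F \<epsilon> in at (0::real). V0.H (of_real \<epsilon>) \<in> \<real>"
    by eventually_elim (use nonneg_Reals_subset_Reals in \<open>auto simp: V0.V_point_def\<close>)
  interpret V_fractional_cauchy \<alpha> p q \<gamma> \<beta> \<rho> \<delta> i n r Y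
    by unfold_locales (use assms H_real in auto)
  note ctx = assms(14,13,16)
  show ?thesis
  proof (intro conjI allI impI)
    show "V0.zero_ivp_solution n r f s y" by (rule y_zero_ivp_solution[OF ctx])
    show "u t = y t" if "V0.zero_ivp_solution n r f s u" "0 < s \<or> continuous_on {0..} u" "0 < t" for u t
      by (rule zero_ivp_unique[OF ctx that])
    assume "\<forall>\<tau>\<ge>0. continuous_on {0..} (\<lambda>t. Y t \<tau>)"
    then show y_cont: "continuous_on {0..} y" using y_continuous[OF ctx] by blast
    show "u t = y t" if "V0.zero_ivp_solution n r f s u" "continuous_on {0..} u" "0 \<le> t" for u t
      by (rule halfline_eqI[OF that(2) y_cont _ that(3)]) (use zero_ivp_unique[OF ctx that(1)] that(2) in blast)
  qed
qed

end
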